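(* Let $V\hookrightarrow H$ be a continuous embedding with $V$ a reflexive Banach space and $H$ a Hilbert space, let $U_{ad}\subset H$ be non-empty and weakly sequentially closed, let $\nu>0$, $y_d\in H$, and let $(y^*,u^* )$ be a local minimiser of $$\min_{\substack{u\in U_{ad}\\ y\in\mathbf Q(u)}}J(y,u),\qquad J(y,u):=\frac12\|y-y_d\|_H^2+\frac\nu2\|u\|_H^2 .$$ Assume that $V$ is a vector lattice induced by a closed convex cone $V_+$ with $V_+\cap(-V_+)=\{0\}$; that $v_n\to v$ in $V$ implies $\sup(0,v_n)\rightharpoonup\sup(0,v)$ in $V$; that there exists $\epsilon>0$ such that $\Phi\colon B_\epsilon(y^* )\to V$ is Lipschitz with Lipschitz constant $C_\Phi<C_a/(C_a+C_b)$; and that $\Phi\colon V\to V$ is Hadamard directionally differentiable at $y^*$. Then $$(\alpha_h,\,y^*-y_d)_H+\nu(u^*,h)_H\ge0\qquad\forall h\in\mathcal T_{U_{ad}}(u^* ),$$ where $\alpha_h\in V$ is the unique solution of $$\alpha_h\in\mathcal K(\alpha_h):\ \langle A\alpha_h-h,\,\alpha_h-v\rangle\le0\ \ \forall v\in\mathcal K(\alpha_h),\qquad\mathcal K(w):=\Phi'(y^* )(w)+\mathcal T_{\mathbf K(y^* )}(y^* )\cap[u^*-Ay^*]^\perp .$$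
   Context: All spaces are real. $H$ is identified with its dual, so $h\in H$ acts on $V$ by $\langle h,v\rangle=(h,v)_H$. The order on $V$ is $u\le v\iff v-u\in V_+$. With $u^+:=\sup(0,u)$, $u^-:=u^+-u$, $A\colon V\to V^*$ is linear and $C_a,C_b>0$ are constants with $\langle Au,v\rangle\le C_b\|u\|_V\|v\|_V$, $\langle Au,u\rangle\ge C_a\|u\|_V^2$, $\langle Au^+,u^-\rangle\le0$ for all $u,v\in V$. $\Phi\colon V\to V$ is a given map. $\mathbf K(w):=\{v\in V:v\le\Phi(w)\}$. For $g\in V^*$, $\mathbf Q(g)$ is the set of all $y\in V$ with $y\in\mathbf K(y)$ and $\langle Ay-g,y-v\rangle\le0$ for all $v\in\mathbf K(y)$. $(y^*,u^* )$ is a local minimiser if $u^*\in U_{ad}$, $y^*\in\mathbf Q(u^* )$ and $J(y^*,u^* )\le J(y,u)$ for all $u\in U_{ad}$, $y\in\mathbf Q(u)$ with $(y,u)$ sufficiently close to $(y^*,u^* )$ in $V\times H$. $B_\epsilon(y)$ is the closed ball in $V$. $\mathcal R_{U_{ad}}(u^* ):=\{h\in H:\exists s^*>0,\ u^*+sh\in U_{ad}\ \forall s\in[0,s^*]\}$ and $\mathcal T_{U_{ad}}(u^* )$ is its closure in $H$; likewise $\mathcal T_{\mathbf K(y^* )}(y^* )$ is the closure in $V$ of $\{h\in V:\exists s^*>0,\ y^*+sh\in\mathbf K(y^* )\ \forall s\in[0,s^*]\}$. $[g]^\perp:=\{v\in V:\langle g,v\rangle=0\}$. Hadamard directional differentiability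 at $y^*$: for every $h\in V$ there is $\Phi'(y^* )(h)\in V$ with $s^{-1}(\Phi(y^*+sh_s)-\Phi(y^* ))\to\Phi'(y^* )(h)$ in $V$ as $s\to0^+$ whenever $h_s\to h$ in $V$. *)

theory Defs
  imports "HOL-Analysis.Analysis"
begin

text \<open>The dual of \<open>'v\<close> is the normed space \<open>'v \<Rightarrow>\<^sub>L real\<close> of bounded linear functionals.\<close>

definition reflexive_space :: "'v::real_normed_vector itself \<Rightarrow> bool" where
  "reflexive_space _ \<longleftrightarrow>
     (\<forall>\<phi> :: ('v \<Rightarrow>\<^sub>L real) \<Rightarrow>\<^sub>L real. \<exists>v::'v. \<forall>f. blinfun_apply \<phi> f = blinfun_apply f v)"

definition weakly_converges :: "(nat \<Rightarrow> 'v::real_normed_vector) \<Rightarrow> 'v \<Rightarrow> bool" where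
  "weakly_converges x l \<longleftrightarrow>
     (\<forall>f :: 'v \<Rightarrow>\<^sub>L real. (\<lambda>n. blinfun_apply f (x n)) \<longlonglongrightarrow> blinfun_apply f l)"

definition weakly_seq_closed :: "'v::real_normed_vector set \<Rightarrow> bool" where
  "weakly_seq_closed S \<longleftrightarrow>
     (\<forall>x l. (\<forall>n. x n \<in> S) \<and> weakly_converges x l \<longrightarrow> l \<in> S)"


definition cone_le :: "'v::real_vector set \<Rightarrow> 'v \<Rightarrow> 'v \<Rightarrow> bool" where
  "cone_le P u v \<longleftrightarrow> v - u \<in> P"

definition is_cone_sup :: "'v::real_vector set \<Rightarrow> 'v \<Rightarrow> 'v \<Rightarrow> 'v \<Rightarrow> bool" where
  "is_cone_sup P u v w \<longleftrightarrow>
     cone_le P u w \<and> cone_le P v w \<and> (\<forall>z. cone_le P u z \<and> cone_le P v z \<longrightarrow> cone_le P w z)"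

definition is_cone_inf :: "'v::real_vector set \<Rightarrow> 'v \<Rightarrow> 'v \<Rightarrow> 'v \<Rightarrow> bool" where
  "is_cone_inf P u v w \<longleftrightarrow>
     cone_le P w u \<and> cone_le P w v \<and> (\<forall>z. cone_le P z u \<and> cone_le P z v \<longrightarrow> cone_le P z w)"

definition cone_sup :: "'v::real_vector set \<Rightarrow> 'v \<Rightarrow> 'v \<Rightarrow> 'v" where
  "cone_sup P u v = (THE w. is_cone_sup P u v w)"

definition vector_lattice_cone :: "'v::real_normed_vector set \<Rightarrow> bool" where
  "vector_lattice_cone P \<longleftrightarrow>
     closed P \<and> convex_cone P \<and> P \<inter> uminus ` P = {0} \<and>
     (\<forall>u v. (\<exists>w. is_cone_sup P u v w) \<and> (\<exists>w. is_cone_inf P u v w))"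

definition pos_part :: "'v::real_vector set \<Rightarrow> 'v \<Rightarrow> 'v" where
  "pos_part P u = cone_sup P 0 u"

definition neg_part :: "'v::real_vector set \<Rightarrow> 'v \<Rightarrow> 'v" where
  "neg_part P u = pos_part P u - u"


text \<open>The functional \<open>v \<mapsto> (h, v)\<^sub>H\<close> on \<open>V\<close>, where \<open>\<iota> : V \<rightarrow> H\<close> is the embedding.\<close>

definition dual_of :: "('v::real_normed_vector \<Rightarrow>\<^sub>L 'h::real_inner) \<Rightarrow> 'h \<Rightarrow> ('v \<Rightarrow>\<^sub>L real)" where
  "dual_of \<iota> h = blinfun_inner_right h o\<^sub>L \<iota>"

definition annihilator :: "('v::real_normed_vector \<Rightarrow>\<^sub>L real) \<Rightarrow> 'v set" where
  "annihilator g = {v. blinfun_apply g v = 0}"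

definition radial_cone :: "'v::real_normed_vector set \<Rightarrow> 'v \<Rightarrow> 'v set" where
  "radial_cone C x = {h. \<exists>s0>0. \<forall>s\<in>{0..s0}. x + s *\<^sub>R h \<in> C}"

definition tangent_cone :: "'v::real_normed_vector set \<Rightarrow> 'v \<Rightarrow> 'v set" where
  "tangent_cone C x = closure (radial_cone C x)"

definition has_hadamard_derivative ::
  "('v::real_normed_vector \<Rightarrow> 'v) \<Rightarrow> ('v \<Rightarrow> 'v) \<Rightarrow> 'v \<Rightarrow> bool" where
  "has_hadamard_derivative \<Phi> \<Phi>' y \<longleftrightarrow>
     (\<forall>h (hs :: real \<Rightarrow> 'v). (hs \<longlongrightarrow> h) (at_right 0) \<longrightarrow>
        ((\<lambda>s. inverse s *\<^sub>R (\<Phi> (y + s *\<^sub>R hs s) - \<Phi> y)) \<longlongrightarrow> \<Phi>' h) (at_right 0))"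


definition constraint_set :: "'v::real_vector set \<Rightarrow> ('v \<Rightarrow> 'v) \<Rightarrow> 'v \<Rightarrow> 'v set" where
  "constraint_set P \<Phi> w = {v. cone_le P v (\<Phi> w)}"

definition QVI_solutions ::
  "('v::real_normed_vector \<Rightarrow> ('v \<Rightarrow>\<^sub>L real)) \<Rightarrow> ('v \<Rightarrow> 'v set) \<Rightarrow> ('v \<Rightarrow>\<^sub>L real) \<Rightarrow> 'v set" where
  "QVI_solutions A K g = {y. y \<in> K y \<and> (\<forall>v\<in>K y. blinfun_apply (A y - g) (y - v) \<le> 0)}"

definition objective ::
  "('v::real_normed_vector \<Rightarrow>\<^sub>L 'h::real_inner) \<Rightarrow> 'h \<Rightarrow> real \<Rightarrow> 'v \<Rightarrow> 'h \<Rightarrow> real" where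
  "objective \<iota> yd \<nu> y u = 1/2 * (norm (blinfun_apply \<iota> y - yd))\<^sup>2 + \<nu>/2 * (norm u)\<^sup>2"

definition local_minimiser ::
  "('v::real_normed_vector \<Rightarrow> 'h::real_normed_vector \<Rightarrow> real) \<Rightarrow> 'h set \<Rightarrow> ('h \<Rightarrow> 'v set)
    \<Rightarrow> 'v \<Rightarrow> 'h \<Rightarrow> bool" where
  "local_minimiser J U_ad Q y0 u0 \<longleftrightarrow>
     u0 \<in> U_ad \<and> y0 \<in> Q u0 \<and>
     (\<exists>r>0. \<forall>u\<in>U_ad. \<forall>y\<in>Q u. dist (y, u) (y0, u0) < r \<longrightarrow> J y0 u0 \<le> J y u)"

text \<open>The set \<open>\<Phi>'(w) + T \<inter> [g]\<^sup>\<bottom>\<close>, with \<open>T\<close> the tangent cone to \<open>C\<close> at \<open>y\<close>.\<close>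

definition linearised_constraint_set ::
  "('v::real_normed_vector \<Rightarrow> 'v) \<Rightarrow> 'v set \<Rightarrow> 'v \<Rightarrow> ('v \<Rightarrow>\<^sub>L real) \<Rightarrow> 'v \<Rightarrow> 'v set" where
  "linearised_constraint_set \<Phi>' C y g w =
     (\<lambda>z. \<Phi>' w + z) ` (tangent_cone C y \<inter> annihilator g)"

end

theory Submission
  imports Defs
begin

text \<open>Close to \<open>y*\<close> the QVI is a contraction, because the solution operator of the variational
  inequality on \<open>\<psi> + C\<close> is Lipschitz in \<open>\<psi>\<close> with constant \<open>1 + C\<^sub>b / C\<^sub>a\<close>. The cone \<open>V\<^sub>+\<close> is
  polyhedric (Mignot), so this operator is directionally differentiable with derivative given by
  the variational inequality on the critical cone; the contraction transfers this to the QVI.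
  Hence \<open>(y\<^sub>s - y*) / s \<rightarrow> \<alpha>\<^sub>h\<close> for feasible directions \<open>h\<close>, and differentiating \<open>J(y\<^sub>s, u* + s h)\<close>
  at \<open>s = 0\<close> gives the inequality; it passes to the tangent cone since \<open>h \<mapsto> \<alpha>\<^sub>h\<close> is Lipschitz.
  As \<open>A\<close> is coercive, its quadratic form makes \<open>V\<close> Hilbertian, which replaces the use of
  reflexivity and of the Hahn-Banach theorem.\<close>

section \<open>Variational inequalities for coercive operators\<close>

locale coercive_operator =
  fixes A :: "'v::banach \<Rightarrow> ('v \<Rightarrow>\<^sub>L real)" and ca cb :: real
  assumes lin: "linear A"
    and ca_pos: "ca > 0" and cb_pos: "cb > 0"
    and bound: "\<And>u v. blinfun_apply (A u) v \<le> cb * norm u * norm v"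
    and coercive: "\<And>u. blinfun_apply (A u) u \<ge> ca * (norm u)\<^sup>2"
begin

section \<open>Basic estimates and minimisation of the quadratic energy\<close>

lemmas A_simps = linear_add[OF lin] linear_diff[OF lin] linear_scale[OF lin] linear_0[OF lin]
  linear_neg[OF lin]

lemma abs_bound: "\<bar>blinfun_apply (A u) v\<bar> \<le> cb * norm u * norm v"
  using bound[of u v] bound[of u "- v"] by (simp add: blinfun.bilinear_simps abs_le_iff)

lemma energy_nonneg: "blinfun_apply (A u) u \<ge> 0"
  using coercive[of u] ca_pos by (smt (verit) mult_nonneg_nonneg zero_le_power2)

lemma norm_A_le: "norm (A u) \<le> cb * norm u"
  using abs_bound[of u] cb_pos by (intro norm_blinfun_bound) auto

lemma bounded_linear_A: "bounded_linear A"
  by (rule bounded_linear_intro[where K = cb])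
     (use norm_A_le in \<open>auto simp: A_simps mult.commute\<close>)

text \<open>Completing the square in \<open>norm v\<close> gives a bound independent of
  \<open>v\<close>, so the energy has a finite infimum over every nonempty set.\<close>

lemma energy_lower:
  "blinfun_apply (A v) v / 2 - blinfun_apply g v \<ge> - (norm g)\<^sup>2 / (2 * ca)"
proof -
  have "blinfun_apply g v \<le> norm g * norm v"
    using norm_blinfun[of g v] by simp
  moreover have "ca / 2 * (norm v)\<^sup>2 - norm g * norm v + (norm g)\<^sup>2 / (2 * ca)
      = (ca * norm v - norm g)\<^sup>2 / (2 * ca)"
    using ca_pos by (simp add: field_simps power2_eq_square)
  moreover have "(ca * norm v - norm g)\<^sup>2 / (2 * ca) \<ge> 0" using ca_pos by simp
  ultimately show ?thesis using coercive[of v] by (simp add: field_simps)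
qed

text \<open>By the parallelogram identity, almost minimisers \<open>x n \<in> D n\<close> form a Cauchy sequence.\<close>

lemma quadratic_nested_minimum:
  fixes g :: "'v \<Rightarrow>\<^sub>L real" and D :: "nat \<Rightarrow> 'v set"
  defines "F \<equiv> \<lambda>v. blinfun_apply (A v) v / 2 - blinfun_apply g v"
  assumes D: "\<And>n. closed (D n)" "\<And>n. convex (D n)" "\<And>n. D n \<noteq> {}" "\<And>n. D (Suc n) \<subseteq> D n"
    and B: "\<And>n. Inf (F ` D n) \<le> B"
  obtains x where "\<And>n. x \<in> D n" "(\<lambda>n. Inf (F ` D n)) \<longlonglongrightarrow> F x"
proof -
  define m where "m n = Inf (F ` D n)" for n
  have bdd: "bdd_below (F ` D n)" for n
    unfolding F_def using energy_lower by (intro bdd_belowI2) blast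
  have m_le: "m n \<le> F v" if "v \<in> D n" for n v
    unfolding m_def using bdd that by (intro cInf_lower) auto
  have "\<exists>v\<in>D n. F v < m n + inverse (real (Suc n))" for n
    using cInf_lessD[of "F ` D n" "m n + inverse (real (Suc n))"] D(3)[of n]
    unfolding m_def by auto
  then obtain x where x: "\<And>n. x n \<in> D n" "\<And>n. F (x n) < m n + inverse (real (Suc n))"
    by metis
  have decD: "D k \<subseteq> D n" if "n \<le> k" for n k
    using lift_Suc_antimono_le[of D, OF D(4) that] .
  have inc: "m n \<le> m k" if "n \<le> k" for n k
    unfolding m_def using D(3) bdd decD[OF that] by (intro cInf_superset_mono) auto
  obtain l where l: "m \<longlonglongrightarrow> l" "\<And>n. m n \<le> l"
    using incseq_convergent[of m B] inc B unfolding m_def[symmetric] incseq_def by metis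
  \<comment> \<open>This comes from the identity in \<open>gap\<close>: \<open>F (x n)\<close>
    exceeds \<open>m n\<close>, and \<open>F (x k)\<close> exceeds \<open>m k \<le> l\<close>, by
    less than \<open>1 / (n + 1)\<close>, while the midpoint has energy at least
    \<open>m n\<close>.\<close>
  define e where "e n = 4 * (l - m n) + 8 * inverse (real (Suc n))" for n
  have e0: "e \<longlonglongrightarrow> 4 * (l - l) + 8 * 0"
    unfolding e_def by (intro tendsto_intros l LIMSEQ_inverse_real_of_nat)
  have gap: "ca * (norm (x n - x k))\<^sup>2 \<le> e n" if "n \<le> k" for n k
  proof -
    have "(1/2) *\<^sub>R x n + (1/2) *\<^sub>R x k \<in> D n"
      using D(2) x(1)[of n] x(1)[of k] decD[OF that] unfolding convex_def
      by (meson subsetD field_sum_of_halves zero_le_divide_1_iff zero_le_numeral)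
    hence mid: "m n \<le> F ((1/2) *\<^sub>R (x n + x k))" using m_le by (simp add: scaleR_add_right)
    \<comment> \<open>Parallelogram identity for the quadratic form of \<open>A\<close>; the linear
      part of \<open>F\<close> cancels.\<close>
    have "blinfun_apply (A (x n - x k)) (x n - x k)
        = 4 * F (x n) + 4 * F (x k) - 8 * F ((1/2) *\<^sub>R (x n + x k))"
      unfolding F_def by (simp add: A_simps blinfun.bilinear_simps algebra_simps)
    moreover have "inverse (real (Suc k)) \<le> inverse (real (Suc n))"
      using that by simp
    ultimately show ?thesis
      using mid x(2)[of n] x(2)[of k] l(2)[of k] coercive[of "x n - x k"] unfolding e_def by argo
  qed
  have "Cauchy x"
  proof (rule metric_CauchyI)
    fix r :: real assume r: "r > 0"
    have "ca * r\<^sup>2 > 0" using r ca_pos by simp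
    with e0 have "\<forall>\<^sub>F n in sequentially. e n < ca * r\<^sup>2"
      by (intro order_tendstoD(2)[OF e0]) simp
    then obtain N where N: "\<And>n. n \<ge> N \<Longrightarrow> e n < ca * r\<^sup>2" by (auto simp: eventually_sequentially)
    have *: "dist (x n) (x k) < r" if "n \<ge> N" "n \<le> k" for n k
    proof -
      have "ca * (norm (x n - x k))\<^sup>2 < ca * r\<^sup>2" using gap[OF that(2)] N[OF that(1)] by linarith
      hence "(norm (x n - x k))\<^sup>2 < r\<^sup>2" using ca_pos by simp
      thus ?thesis using r by (simp add: dist_norm power2_less_imp_less)
    qed
    show "\<exists>M. \<forall>m\<ge>M. \<forall>n\<ge>M. dist (x m) (x n) < r"
      using * by (metis dist_commute nat_le_linear)
  qed
  then obtain y where y: "x \<longlonglongrightarrow> y" using Cauchy_convergent_iff convergent_def by blast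
  have "y \<in> D n" for n
  proof (rule Lim_in_closed_set[OF D(1) _ _ y])
    show "\<forall>\<^sub>F k in sequentially. x k \<in> D n"
      using x(1) decD unfolding eventually_sequentially by blast
  qed simp
  moreover have "m \<longlonglongrightarrow> F y"
  proof -
    have Fx: "(\<lambda>n. F (x n)) \<longlonglongrightarrow> F y"
      unfolding F_def
      by (intro tendsto_intros y bounded_linear.tendsto[OF bounded_linear_A])
         simp
    have "(\<lambda>n. F (x n)) \<longlonglongrightarrow> l"
    proof (rule tendsto_sandwich[OF _ _ l(1)])
      show "(\<lambda>n. m n + inverse (real (Suc n))) \<longlonglongrightarrow> l"
        using tendsto_add[OF l(1) LIMSEQ_inverse_real_of_nat] by simp
      show "\<forall>\<^sub>F n in sequentially. m n \<le> F (x n)" using m_le x(1) by simp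
      show "\<forall>\<^sub>F n in sequentially. F (x n) \<le> m n + inverse (real (Suc n))"
        by (intro always_eventually allI less_imp_le x(2))
    qed
    thus ?thesis using Fx l(1) LIMSEQ_unique by blast
  qed
  ultimately show ?thesis using that unfolding m_def by blast
qed

text \<open>Boundedness of \<open>D 0\<close> bounds the minimal energies over all
  \<open>D n\<close>, so \<open>quadratic_nested_minimum\<close> yields a common point. This stands
  in for weak compactness of bounded closed convex sets.\<close>

lemma nested_convex_Inter:
  fixes D :: "nat \<Rightarrow> 'v set"
  assumes D: "\<And>n. closed (D n)" "\<And>n. convex (D n)" "\<And>n. D n \<noteq> {}" "\<And>n. D (Suc n) \<subseteq> D n"
    and b: "bounded (D 0)"
  shows "(\<Inter>n. D n) \<noteq> {}"
proof -
  let ?F = "\<lambda>v. blinfun_apply (A v) v / 2 - blinfun_apply 0 v"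
  obtain M where M: "\<And>v. v \<in> D 0 \<Longrightarrow> norm v \<le> M" using b unfolding bounded_iff by blast
  have B: "Inf (?F ` D n) \<le> \<bar>cb\<bar> * M * M / 2" for n
  proof -
    obtain v where v: "v \<in> D n" using D(3) by blast
    have "v \<in> D 0" using v lift_Suc_antimono_le[of D, OF D(4), of 0 n] by auto
    hence nv: "norm v \<le> M" by (rule M)
    have "Inf (?F ` D n) \<le> ?F v"
      using v energy_nonneg by (intro cInf_lower bdd_belowI2[where m = 0]) auto
    also have "?F v \<le> cb * norm v * norm v / 2" using bound[of v v] by simp
    also have "cb * norm v * norm v \<le> \<bar>cb\<bar> * M * M"
      using nv norm_ge_zero[of v] by (intro mult_mono mult_nonneg_nonneg) linarith+
    finally show ?thesis by simp
  qed
  show ?thesis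
    by (rule quadratic_nested_minimum[where D = D and g = 0, OF D B]) blast
qed

section \<open>Existence, uniqueness and stability for a fixed convex set\<close>

abbreviation VI :: "'v set \<Rightarrow> ('v \<Rightarrow>\<^sub>L real) \<Rightarrow> 'v set" where
  "VI C \<equiv> QVI_solutions A (\<lambda>_. C)"

text \<open>For a symmetric form the inequality is the first-order condition for minimising the
  energy over \<open>C\<close>; the minimiser comes from a constant sequence of sets.\<close>

lemma VI_exists_symmetric:
  assumes sym: "\<And>u v. blinfun_apply (A u) v = blinfun_apply (A v) u"
    and C: "closed C" "convex C" "C \<noteq> {}"
  shows "\<exists>y. y \<in> VI C g"
proof -
  define F where "F v = blinfun_apply (A v) v / 2 - blinfun_apply g v" for v
  obtain y where y: "y \<in> C" "(\<lambda>n::nat. Inf (F ` C)) \<longlonglongrightarrow> F y"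
    using quadratic_nested_minimum[of "\<lambda>_. C" g "Inf (F ` C)"] C unfolding F_def by auto
  have eq: "F y = Inf (F ` C)" using y(2) by (simp add: LIMSEQ_const_iff)
  have min: "F y \<le> F v" if "v \<in> C" for v
    unfolding eq using that energy_lower F_def by (intro cInf_lower bdd_belowI2) auto
  have "blinfun_apply (A y - g) (y - v) \<le> 0" if v: "v \<in> C" for v
  proof -
    define X where "X = blinfun_apply (A y - g) (v - y)"
    define E where "E = blinfun_apply (A (v - y)) (v - y)"
    \<comment> \<open>Compare \<open>y\<close> with a point on the segment to \<open>v\<close> and
      divide by \<open>t\<close>. Symmetry merges the two mixed terms into the first variation
      \<open>X\<close>; the limit t to 0 then gives \<open>X \<ge> 0\<close>.\<close>
    have *: "- X \<le> t * (E / 2)" if t: "0 < t" "t \<le> 1" for t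
    proof -
      have "(1 - t) *\<^sub>R y + t *\<^sub>R v \<in> C" using C(2) y(1) v t unfolding convex_alt by auto
      hence "F y \<le> F (y + t *\<^sub>R (v - y))" using min by (simp add: algebra_simps)
      also have "F (y + t *\<^sub>R (v - y)) = F y + t * (X + t * (E / 2))"
        unfolding F_def X_def E_def using sym[of v y]
        by (simp add: A_simps blinfun.bilinear_simps field_simps)
      finally have "0 \<le> t * (X + t * (E / 2))" by simp
      thus ?thesis using t by (simp add: zero_le_mult_iff)
    qed
    have "((\<lambda>t. t * (E / 2)) \<longlongrightarrow> 0 * (E / 2)) (at_right 0)" by (intro tendsto_intros)
    moreover have "\<forall>\<^sub>F t in at_right 0. - X \<le> t * (E / 2)"
      using * unfolding eventually_at_right_field by (metis less_imp_le zero_less_one)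
    ultimately have "- X \<le> 0 * (E / 2)" by (rule tendsto_lowerbound) simp
    moreover have "blinfun_apply (A y - g) (y - v) = - X"
      unfolding X_def by (simp add: blinfun.bilinear_simps)
    ultimately show ?thesis by simp
  qed
  thus ?thesis using y(1) unfolding QVI_solutions_def by blast
qed

text \<open>Test each inequality with the other solution, add, and use coercivity on the
  difference.\<close>

lemma VI_lipschitz:
  assumes "x \<in> VI C f" "y \<in> VI C g"
  shows "norm (x - y) \<le> norm (f - g) / ca"
proof (cases "x = y")
  case False
  have "blinfun_apply (A x - f) (x - y) \<le> 0" "blinfun_apply (A y - g) (y - x) \<le> 0"
    using assms unfolding QVI_solutions_def by auto
  hence "blinfun_apply (A (x - y)) (x - y) \<le> blinfun_apply (f - g) (x - y)"
    by (simp add: A_simps blinfun.bilinear_simps)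
  also have "\<dots> \<le> norm (f - g) * norm (x - y)"
    using norm_blinfun[of "f - g" "x - y"] by simp
  finally have "ca * norm (x - y) * norm (x - y) \<le> norm (f - g) * norm (x - y)"
    using coercive[of "x - y"] by (simp add: power2_eq_square mult.assoc)
  hence "ca * norm (x - y) \<le> norm (f - g)" using False by simp
  thus ?thesis using ca_pos by (simp add: field_simps)
qed (use ca_pos in simp)

lemma VI_unique:
  assumes "x \<in> VI C g" "y \<in> VI C g" shows "x = y"
  using VI_lipschitz[OF assms] by simp

section \<open>Homotopy from the symmetric part to the full operator\<close>

definition adj :: "'v \<Rightarrow> ('v \<Rightarrow>\<^sub>L real)" where
  "adj u = Blinfun (\<lambda>v. blinfun_apply (A v) u)"

lemma adj_apply [simp]: "blinfun_apply (adj u) v = blinfun_apply (A v) u"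
proof -
  have "bounded_linear (\<lambda>v. blinfun_apply (A v) u)"
    using bounded_linear_A by (rule bounded_linear_compose[OF blinfun.bounded_linear_left])
  thus ?thesis unfolding adj_def by (simp add: bounded_linear_Blinfun_apply)
qed

text \<open>This is the symmetric part of \<open>A\<close> plus \<open>t\<close> times its
  antisymmetric part.\<close>

definition homotopy :: "real \<Rightarrow> 'v \<Rightarrow> ('v \<Rightarrow>\<^sub>L real)" where
  "homotopy t u = ((1 + t) / 2) *\<^sub>R A u + ((1 - t) / 2) *\<^sub>R adj u"

text \<open>On the diagonal \<open>A\<close> and \<open>adj\<close> agree, which preserves
  \<open>ca\<close>; off the diagonal the form is a convex combination of \<open>A u v\<close> and
  \<open>A v u\<close>, which preserves \<open>cb\<close>.\<close>

lemma coercive_operator_homotopy: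
  assumes t: "0 \<le> t" "t \<le> 1"
  shows "coercive_operator (homotopy t) ca cb"
  unfolding coercive_operator_def
proof (intro conjI allI)
  show "linear (homotopy t)"
    by (rule linearI; rule blinfun_eqI)
       (simp_all add: homotopy_def A_simps blinfun.bilinear_simps field_simps)
  show "blinfun_apply (homotopy t u) v \<le> cb * norm u * norm v" for u v
  proof -
    have "blinfun_apply (homotopy t u) v
        = ((1 + t) / 2) * blinfun_apply (A u) v + ((1 - t) / 2) * blinfun_apply (A v) u"
      by (simp add: homotopy_def blinfun.bilinear_simps)
    also have "\<dots> \<le> ((1 + t) / 2) * (cb * norm u * norm v) + ((1 - t) / 2) * (cb * norm v * norm u)"
      using t bound by (intro add_mono mult_left_mono) auto
    also have "\<dots> = cb * norm u * norm v" by (simp add: field_simps)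
    finally show ?thesis .
  qed
  have "blinfun_apply (homotopy t u) u = blinfun_apply (A u) u" for u
    by (simp add: homotopy_def blinfun.bilinear_simps field_simps)
  thus "ca * (norm u)\<^sup>2 \<le> blinfun_apply (homotopy t u) u" for u using coercive by simp
qed (rule ca_pos cb_pos)+

text \<open>Solvability propagates from the symmetric part \<open>homotopy 0\<close> to \<open>A = homotopy 1\<close>:
  the antisymmetric part does not affect coercivity, so each step of fixed length is a contraction.\<close>

lemma VI_exists:
  assumes C: "closed C" "convex C" "C \<noteq> {}"
  shows "\<exists>y. y \<in> VI C g"
proof -
  \<comment> \<open>\<open>N\<close> steps of length \<open>d = 1 / N\<close> lead from 0 to 1, and
    this \<open>N\<close> makes the contraction constant \<open>d * \<bar>cb\<bar> / ca\<close> of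
    each step at most 1/2.\<close>
  obtain N :: nat where N: "real N > 2 * \<bar>cb\<bar> / ca" using reals_Archimedean2 by blast
  have Npos: "real N > 0" using N ca_pos
    by (smt (verit) divide_nonneg_pos abs_ge_zero)
  define d where "d = 1 / real N"
  have small: "d * \<bar>cb\<bar> / ca \<le> 1 / 2"
    using N Npos ca_pos unfolding d_def by (simp add: field_simps)
  have "\<exists>y. y \<in> QVI_solutions (homotopy (real n * d)) (\<lambda>_. C) g" if "n \<le> N" for n g
    using that
  proof (induction n arbitrary: g)
    case 0
    interpret S: coercive_operator "homotopy 0" ca cb by (rule coercive_operator_homotopy) auto
    have "\<exists>y. y \<in> S.VI C g"
      by (rule S.VI_exists_symmetric[OF _ C])
         (simp add: homotopy_def blinfun.bilinear_simps add.commute)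
    thus ?case by simp
  next
    case (Suc n)
    have "real n * d \<le> 1" using Suc.prems Npos unfolding d_def by simp
    then interpret S: coercive_operator "homotopy (real n * d)" ca cb
      by (intro coercive_operator_homotopy) (simp_all add: d_def)
    \<comment> \<open>The antisymmetric part: one step adds \<open>d *\<^sub>R D\<close> to the
      operator. Moving this term to the data turns the new inequality into a fixed point problem for
      the previous solution operator.\<close>
    define D where "D u = (1/2) *\<^sub>R (A u - adj u)" for u
    have Ddiff: "D u - D v = D (u - v)" for u v
      unfolding D_def by (rule blinfun_eqI) (simp add: A_simps blinfun.bilinear_simps algebra_simps)
    have Dbound: "norm (D u) \<le> \<bar>cb\<bar> * norm u" for u
    proof (rule norm_blinfun_bound)
      fix v :: 'v
      have le: "cb * norm u * norm v \<le> \<bar>cb\<bar> * norm u * norm v" by (intro mult_right_mono) auto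
      have "norm (blinfun_apply (D u) v) = \<bar>blinfun_apply (A u) v - blinfun_apply (A v) u\<bar> / 2"
        unfolding D_def by (simp add: blinfun.bilinear_simps)
      also have "\<dots> \<le> (cb * norm u * norm v + cb * norm u * norm v) / 2"
        using abs_bound[of u v] abs_bound[of v u]
        by (intro divide_right_mono order_trans[OF abs_triangle_ineq4]) (auto simp: mult.commute mult.left_commute)
      finally show "norm (blinfun_apply (D u) v) \<le> \<bar>cb\<bar> * norm u * norm v" using le by simp
    qed simp
    obtain S where S: "\<And>g. S g \<in> S.VI C g" using Suc by (metis Suc_leD)
    define T where "T y = S (g - d *\<^sub>R D y)" for y
    have contr: "dist (T x) (T y) \<le> 1/2 * dist x y" for x y
    proof -
      have "norm (T x - T y) \<le> norm ((g - d *\<^sub>R D x) - (g - d *\<^sub>R D y)) / ca"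
        unfolding T_def by (rule S.VI_lipschitz[OF S S])
      also have "(g - d *\<^sub>R D x) - (g - d *\<^sub>R D y) = d *\<^sub>R D (y - x)"
        unfolding Ddiff[symmetric] by (simp add: algebra_simps)
      also have "norm \<dots> / ca \<le> d * (\<bar>cb\<bar> * norm (y - x)) / ca"
        using Dbound[of "y - x"] ca_pos Npos by (simp add: d_def divide_right_mono)
      also have "\<dots> \<le> 1/2 * norm (x - y)"
        using mult_right_mono[OF small, of "norm (x - y)"] by (simp add: norm_minus_commute algebra_simps)
      finally show ?thesis by (simp add: dist_norm)
    qed
    obtain y where y: "T y = y"
      using banach_fix_type[of "1/2" T] contr by auto
    have eq: "homotopy (real (Suc n) * d) y - g = homotopy (real n * d) y - (g - d *\<^sub>R D y)"
      by (rule blinfun_eqI) (simp add: homotopy_def D_def blinfun.bilinear_simps field_simps)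
    have "y \<in> S.VI C (g - d *\<^sub>R D y)"
      using S[of "g - d *\<^sub>R D y"] y unfolding T_def by simp
    hence "y \<in> QVI_solutions (homotopy (real (Suc n) * d)) (\<lambda>_. C) g"
      unfolding QVI_solutions_def mem_Collect_eq eq .
    thus ?case by blast
  qed
  from this[of N g] Npos show ?thesis
    by (simp add: d_def homotopy_def[abs_def])
qed

definition VI_sol :: "'v set \<Rightarrow> ('v \<Rightarrow>\<^sub>L real) \<Rightarrow> 'v" where
  "VI_sol C g = (THE y. y \<in> VI C g)"

lemma VI_sol_mem:
  assumes "closed C" "convex C" "C \<noteq> {}"
  shows "VI_sol C g \<in> VI C g"
  unfolding VI_sol_def by (rule theI') (use VI_exists[OF assms] VI_unique in blast)

text \<open>Mazur's lemma, by testing the variational inequality with data \<open>A v\<close>.\<close>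

lemma weak_limit_in_closed_convex:
  fixes C :: "'v set"
  assumes C: "closed C" "convex C" and w: "weakly_converges w v" "\<And>n::nat. w n \<in> C"
  shows "v \<in> C"
proof -
  obtain p where p: "p \<in> VI C (A v)" using VI_exists[OF C] w(2) by blast
  have "blinfun_apply (A p - A v) (p - w n) \<le> 0" for n
    using p w(2) unfolding QVI_solutions_def by blast
  hence "blinfun_apply (A p - A v) p \<le> blinfun_apply (A p - A v) (w n)" for n
    by (simp add: blinfun.diff_right)
  moreover have "(\<lambda>n. blinfun_apply (A p - A v) (w n)) \<longlonglongrightarrow> blinfun_apply (A p - A v) v"
    using w(1) unfolding weakly_converges_def by blast
  ultimately have "blinfun_apply (A p - A v) p \<le> blinfun_apply (A p - A v) v"
    by (meson LIMSEQ_le_const)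
  hence "blinfun_apply (A (p - v)) (p - v) \<le> 0" by (simp add: A_simps blinfun.diff_right)
  hence "ca * (norm (p - v))\<^sup>2 \<le> 0" using coercive[of "p - v"] by linarith
  hence "p = v" using ca_pos by (simp add: mult_le_0_iff)
  thus ?thesis using p unfolding QVI_solutions_def by blast
qed

section \<open>Quasi-variational inequalities with translated constraint sets\<close>

text \<open>Subtracting the shift \<open>\<phi> y\<close> leaves a variational inequality on the
  fixed set \<open>C\<close>, with data changed by \<open>A (\<phi> y)\<close>. All QVI results
  below use this fixed point form.\<close>

lemma QVI_translate_iff:
  assumes K: "\<And>w. K w = (\<lambda>z. \<phi> w + z) ` C"
  shows "y \<in> QVI_solutions A K g \<longleftrightarrow> y - \<phi> y \<in> VI C (g - A (\<phi> y))"
proof -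
  have "y \<in> K y \<longleftrightarrow> y - \<phi> y \<in> C"
    unfolding K by (metis (no_types, lifting) add_diff_cancel_left' diff_add_cancel add.commute image_iff)
  moreover have "(\<forall>v\<in>K y. blinfun_apply (A y - g) (y - v) \<le> 0) \<longleftrightarrow>
     (\<forall>v\<in>C. blinfun_apply (A (y - \<phi> y) - (g - A (\<phi> y))) (y - \<phi> y - v) \<le> 0)"
    unfolding K by (simp add: A_simps diff_diff_eq)
  ultimately show ?thesis unfolding QVI_solutions_def by blast
qed

text \<open>A change of the shift acts twice: directly on the solution, with factor 1, and through
  the data \<open>A p\<close>, with factor \<open>cb / ca\<close>.\<close>

lemma VI_translate_lipschitz:
  assumes "x - p \<in> VI C (f - A p)" "y - q \<in> VI C (g - A q)"
  shows "norm (x - y) \<le> norm (f - g) / ca + (1 + cb / ca) * norm (p - q)"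
proof -
  have "norm ((x - p) - (y - q)) \<le> norm ((f - A p) - (g - A q)) / ca"
    by (rule VI_lipschitz[OF assms])
  also have "(f - A p) - (g - A q) = (f - g) - A (p - q)" by (simp add: A_simps)
  also have "norm \<dots> / ca \<le> (norm (f - g) + cb * norm (p - q)) / ca"
    using norm_triangle_ineq4[of "f - g" "A (p - q)"] norm_A_le[of "p - q"] ca_pos
    by (intro divide_right_mono) auto
  finally have "norm ((x - p) - (y - q)) \<le> norm (f - g) / ca + cb / ca * norm (p - q)"
    by (simp add: add_divide_distrib)
  moreover have "norm (x - y) \<le> norm ((x - p) - (y - q)) + norm (p - q)"
    using norm_triangle_ineq[of "(x - p) - (y - q)" "p - q"] by simp
  ultimately show ?thesis by (simp add: algebra_simps)
qed

text \<open>The Lipschitz bound on \<open>\<phi>\<close> lets the shift term be absorbed on the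
  left. For a positive factor this gives uniqueness in \<open>D\<close> and stability.\<close>

lemma QVI_lipschitz:
  assumes K: "\<And>w. K w = (\<lambda>z. \<phi> w + z) ` C" and L: "L-lipschitz_on D \<phi>"
    and x: "x \<in> QVI_solutions A K f" "x \<in> D" and y: "y \<in> QVI_solutions A K g" "y \<in> D"
  shows "(1 - (1 + cb / ca) * L) * norm (x - y) \<le> norm (f - g) / ca"
proof -
  have "norm (x - y) \<le> norm (f - g) / ca + (1 + cb / ca) * norm (\<phi> x - \<phi> y)"
    using x(1) y(1) unfolding QVI_translate_iff[OF K] by (rule VI_translate_lipschitz)
  also have "\<dots> \<le> norm (f - g) / ca + (1 + cb / ca) * (L * norm (x - y))"
    using lipschitz_onD[OF L x(2) y(2)] ca_pos cb_pos
    by (intro add_left_mono mult_left_mono) (auto simp: dist_norm)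
  finally show ?thesis by (simp add: algebra_simps)
qed

text \<open>Banach's fixed point theorem for the map that freezes the shift at \<open>w\<close>. It
  serves both with a ball as \<open>D\<close> (original problem) and with the whole space
  (linearised problem).\<close>

lemma QVI_exists:
  assumes C: "closed C" "convex C" "C \<noteq> {}"
    and K: "\<And>w. K w = (\<lambda>z. \<phi> w + z) ` C" and L: "L-lipschitz_on D \<phi>"
    and D: "complete D" "D \<noteq> {}" and small: "(1 + cb / ca) * L < 1"
    and maps: "\<And>w. w \<in> D \<Longrightarrow> \<phi> w + VI_sol C (g - A (\<phi> w)) \<in> D"
  shows "\<exists>y\<in>D. y \<in> QVI_solutions A K g"
proof -
  define T where "T w = \<phi> w + VI_sol C (g - A (\<phi> w))" for w
  have T: "T w - \<phi> w \<in> VI C (g - A (\<phi> w))" for w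
    unfolding T_def using VI_sol_mem[OF C] by simp
  have "dist (T x) (T y) \<le> (1 + cb / ca) * L * dist x y" if "x \<in> D" "y \<in> D" for x y
  proof -
    have "norm (T x - T y) \<le> (1 + cb / ca) * norm (\<phi> x - \<phi> y)"
      using VI_translate_lipschitz[OF T T, of x y] by simp
    also have "\<dots> \<le> (1 + cb / ca) * (L * dist x y)"
      using lipschitz_onD[OF L that] ca_pos cb_pos
      by (intro mult_left_mono) (auto simp: dist_norm)
    finally show ?thesis by (simp add: dist_norm mult.assoc)
  qed
  moreover have "0 \<le> (1 + cb / ca) * L" using lipschitz_on_nonneg[OF L] ca_pos cb_pos by simp
  ultimately obtain y where "y \<in> D" "T y = y"
    using Banach_fix[OF D, of "(1 + cb / ca) * L" T] small maps unfolding T_def by blast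
  thus ?thesis using T[of y] unfolding QVI_translate_iff[OF K] by auto
qed

lemma QVI_exists_near:
  assumes C: "closed C" "convex C" "C \<noteq> {}"
    and K: "\<And>w. K w = (\<lambda>z. \<phi> w + z) ` C" and L: "L-lipschitz_on (cball y0 \<epsilon>) \<phi>"
    and small: "(1 + cb / ca) * L < 1" and \<epsilon>: "\<epsilon> > 0" and y0: "y0 \<in> QVI_solutions A K g0"
    and g: "norm (g - g0) / ca \<le> (1 - (1 + cb / ca) * L) * \<epsilon>"
  shows "\<exists>y\<in>cball y0 \<epsilon>. y \<in> QVI_solutions A K g"
proof (rule QVI_exists[OF C K L _ _ small])
  show "complete (cball y0 \<epsilon>)" by (simp add: complete_eq_closed)
  show "cball y0 \<epsilon> \<noteq> {}" using \<epsilon> by simp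
  fix w assume w: "w \<in> cball y0 \<epsilon>"
  define z where "z = \<phi> w + VI_sol C (g - A (\<phi> w))"
  have "z - \<phi> w \<in> VI C (g - A (\<phi> w))" unfolding z_def using VI_sol_mem[OF C] by simp
  from VI_translate_lipschitz[OF this] y0
  have "norm (z - y0) \<le> norm (g - g0) / ca + (1 + cb / ca) * norm (\<phi> w - \<phi> y0)"
    unfolding QVI_translate_iff[OF K] by blast
  \<comment> \<open>The data perturbation uses up exactly the part of the radius that the
    contraction leaves free, so the ball is mapped into itself.\<close>
  also have "\<dots> \<le> (1 - (1 + cb / ca) * L) * \<epsilon> + (1 + cb / ca) * (L * \<epsilon>)"
  proof (intro add_mono mult_left_mono g)
    have "norm (\<phi> w - \<phi> y0) \<le> L * dist w y0"
      using lipschitz_onD[OF L w, of y0] \<epsilon> by (simp add: dist_norm)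
    also have "\<dots> \<le> L * \<epsilon>"
      using w lipschitz_on_nonneg[OF L] by (intro mult_left_mono) (auto simp: dist_commute)
    finally show "norm (\<phi> w - \<phi> y0) \<le> L * \<epsilon>" .
  qed (use ca_pos cb_pos in simp)
  also have "\<dots> = \<epsilon>" by (simp add: algebra_simps)
  finally show "\<phi> w + VI_sol C (g - A (\<phi> w)) \<in> cball y0 \<epsilon>"
    unfolding z_def[symmetric] by (simp add: dist_norm norm_minus_commute)
qed

text \<open>Replaces weak sequential compactness of bounded sets: a functional that is nonnegative on
  \<open>T \<inter> [\<mu>]\<^sup>\<bottom>\<close> is almost nonnegative at bounded points of \<open>T\<close> where \<open>\<mu>\<close> is small.\<close>

lemma almost_nonneg_near_annihilator:
  assumes T: "closed T" "convex T" and f: "\<And>v. v \<in> T \<inter> annihilator \<mu> \<Longrightarrow> 0 \<le> blinfun_apply f v"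
    and e: "e > (0::real)"
  obtains d where "d > 0" "\<And>v. v \<in> T \<Longrightarrow> norm v \<le> M \<Longrightarrow> \<bar>blinfun_apply \<mu> v\<bar> \<le> d
    \<Longrightarrow> - e < blinfun_apply f (v::'v)"
proof (rule ccontr)
  assume neg: "\<not> thesis"
  \<comment> \<open>The bounded counterexamples to the threshold \<open>1 / (n + 1)\<close>. If no
    threshold works, all these sets are nonempty; a common point lies in \<open>T\<close>, is
    annihilated by \<open>\<mu>\<close>, and has \<open>f\<close> at most
    \<open>- e\<close>.\<close>
  define D where "D n = T \<inter> cball 0 M \<inter> {v. blinfun_apply \<mu> v \<le> inverse (real (Suc n))}
    \<inter> {v. - inverse (real (Suc n)) \<le> blinfun_apply \<mu> v} \<inter> {v. blinfun_apply f v \<le> - e}" for n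
  have "(\<Inter>n. D n) \<noteq> {}"
  proof (rule nested_convex_Inter)
    show "closed (D n)" for n
      unfolding D_def by (intro closed_Int T closed_cball closed_Collect_le continuous_intros)
    have half: "convex {v. blinfun_apply h v \<le> r}" for h :: "'v \<Rightarrow>\<^sub>L real" and r
      unfolding convex_alt by (auto simp: blinfun.bilinear_simps intro: convex_bound_le)
    moreover have "convex {v. - r \<le> blinfun_apply h v}" for h :: "'v \<Rightarrow>\<^sub>L real" and r
      using half[of "- h" r] by (simp add: blinfun.minus_left minus_le_iff)
    ultimately show "convex (D n)" for n
      unfolding D_def by (intro convex_Int T convex_cball)
    show "D (Suc n) \<subseteq> D n" for n
    proof -
      have le: "inverse (real (Suc (Suc n))) \<le> inverse (real (Suc n))" by simp
      show ?thesis
        unfolding D_def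
        by (auto simp del: of_nat_Suc intro: order_trans[OF _ le] order_trans[OF le_imp_neg_le[OF le]])
    qed
    show "D n \<noteq> {}" for n
    proof
      assume "D n = {}"
      hence "- e < blinfun_apply f v"
        if "v \<in> T" "norm v \<le> M" "\<bar>blinfun_apply \<mu> v\<bar> \<le> inverse (real (Suc n))" for v
        using that unfolding D_def abs_le_iff by fastforce
      thus False using neg that[of "inverse (real (Suc n))"] by auto
    qed
    show "bounded (D 0)" unfolding D_def by (meson bounded_cball bounded_Int)
  qed
  then obtain v where v: "\<And>n. v \<in> D n" by blast
  have "\<bar>blinfun_apply \<mu> v\<bar> \<le> inverse (real (Suc n))" for n
    using v[of n] unfolding D_def by (auto simp: abs_le_iff minus_le_iff)
  hence "\<bar>blinfun_apply \<mu> v\<bar> \<le> 0"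
    using LIMSEQ_le_const[OF LIMSEQ_inverse_real_of_nat] by blast
  hence "v \<in> T \<inter> annihilator \<mu>" using v[of 0] unfolding D_def annihilator_def by simp
  thus False using f e v[of 0] unfolding D_def by fastforce
qed

end

section \<open>Directional differentiability\<close>

lemma zero_in_radial_cone: "x \<in> C \<Longrightarrow> 0 \<in> radial_cone C x"
  unfolding radial_cone_def by (auto intro: exI[of _ 1])

text \<open>By convexity the segment from \<open>x\<close> stays in \<open>C\<close>, so a single
  positive step length certifies a radial direction.\<close>

lemma radial_coneI:
  assumes "convex C" "x \<in> C" "t > 0" "x + t *\<^sub>R h \<in> C"
  shows "h \<in> radial_cone C x"
proof -
  have "x + s *\<^sub>R h \<in> C" if "s \<in> {0..t}" for s
  proof -
    have "(1 - s / t) *\<^sub>R x + (s / t) *\<^sub>R (x + t *\<^sub>R h) \<in> C"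
      using assms that unfolding convex_alt by auto
    thus ?thesis using assms(3) by (simp add: algebra_simps)
  qed
  thus ?thesis using assms(3) unfolding radial_cone_def by blast
qed

lemma convex_radial_cone:
  assumes C: "convex C" and x: "x \<in> C"
  shows "convex (radial_cone C x)"
  unfolding convex_alt
proof (intro ballI allI impI)
  fix a b and u :: real
  assume ab: "a \<in> radial_cone C x" "b \<in> radial_cone C x" and u: "0 \<le> u \<and> u \<le> 1"
  obtain s t where st: "s > 0" "\<And>r. r \<in> {0..s} \<Longrightarrow> x + r *\<^sub>R a \<in> C"
      "t > 0" "\<And>r. r \<in> {0..t} \<Longrightarrow> x + r *\<^sub>R b \<in> C"
    using ab unfolding radial_cone_def by blast
  define r where "r = min s t"
  have "x + r *\<^sub>R a \<in> C" "x + r *\<^sub>R b \<in> C" "r > 0" using st unfolding r_def by auto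
  hence "(1 - u) *\<^sub>R (x + r *\<^sub>R a) + u *\<^sub>R (x + r *\<^sub>R b) \<in> C"
    using C u unfolding convex_alt by blast
  hence "x + r *\<^sub>R ((1 - u) *\<^sub>R a + u *\<^sub>R b) \<in> C" by (simp add: algebra_simps)
  thus "(1 - u) *\<^sub>R a + u *\<^sub>R b \<in> radial_cone C x" using radial_coneI C x \<open>r > 0\<close> by blast
qed

lemma closed_annihilator: "closed (annihilator g)"
  unfolding annihilator_def by (intro closed_Collect_eq continuous_intros)

lemma convex_annihilator: "convex (annihilator g)"
  unfolding annihilator_def convex_alt by (simp add: blinfun.bilinear_simps)

lemma critical_cone:
  assumes "convex C" "x \<in> C"
  shows "closed (tangent_cone C x \<inter> annihilator g)" "convex (tangent_cone C x \<inter> annihilator g)"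
    "0 \<in> tangent_cone C x \<inter> annihilator g"
  using convex_radial_cone[OF assms] zero_in_radial_cone[OF assms(2)]
    closure_subset[of "radial_cone C x"]
  unfolding tangent_cone_def
  by (auto intro!: closed_Int convex_Int convex_closure closed_annihilator convex_annihilator)
     (simp add: annihilator_def)

lemma norm_inverse_scaleR: "s > 0 \<Longrightarrow> norm (inverse s *\<^sub>R v) = norm v / s"
  by (simp add: divide_inverse_commute)

lemma at_right_0_eventually_le: "t > (0::real) \<Longrightarrow> \<forall>\<^sub>F s in at_right 0. 0 < s \<and> s \<le> t"
  unfolding eventually_at_right_field by (auto intro!: exI[of _ t])

lemma eventually_line_in_cball:
  fixes y :: "'a::real_normed_vector"
  assumes \<epsilon>: "\<epsilon> > 0"
  shows "\<forall>\<^sub>F s in at_right 0. y + s *\<^sub>R h \<in> cball y \<epsilon>"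
proof -
  \<comment> \<open>Adding 1 keeps the denominator positive when \<open>h = 0\<close>.\<close>
  have "\<epsilon> / (norm h + 1) > 0" using \<epsilon> by (simp add: add_nonneg_pos)
  from at_right_0_eventually_le[OF this] show ?thesis
  proof eventually_elim
    case (elim s)
    have "s * norm h \<le> s * (norm h + 1)" using elim by simp
    also have "\<dots> \<le> \<epsilon>" using elim by (simp add: pos_le_divide_eq add_nonneg_pos)
    finally show ?case using elim by (simp add: dist_norm)
  qed
qed

section \<open>Derivatives of the two solution maps\<close>

context coercive_operator
begin

text \<open>Testing the variational inequality with \<open>x0 + s d\<close> for a radial direction
  \<open>d \<in> [g0 - A x0]\<^sup>\<bottom>\<close> near \<open>\<delta>\<close> controls the difference quotients; polyhedricity provides \<open>d\<close>.\<close>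

lemma VI_directional_derivative:
  assumes C: "closed C" "convex C" and x0: "x0 \<in> VI C g0"
  defines "\<mu> \<equiv> g0 - A x0"
  assumes poly: "tangent_cone C x0 \<inter> annihilator \<mu> \<subseteq> closure (radial_cone C x0 \<inter> annihilator \<mu>)"
    and \<delta>: "\<delta> \<in> VI (tangent_cone C x0 \<inter> annihilator \<mu>) k"
  shows "((\<lambda>s. inverse s *\<^sub>R (VI_sol C (g0 + s *\<^sub>R k) - x0)) \<longlongrightarrow> \<delta>) (at_right 0)"
proof -
  define x where "x s = VI_sol C (g0 + s *\<^sub>R k)" for s
  define q where "q s = inverse s *\<^sub>R (x s - x0)" for s
  have x0C: "x0 \<in> C" using x0 unfolding QVI_solutions_def by blast
  hence ne: "C \<noteq> {}" by blast
  have x: "x s \<in> VI C (g0 + s *\<^sub>R k)" for s unfolding x_def by (rule VI_sol_mem[OF C ne])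
  have xq: "x s = x0 + s *\<^sub>R q s" if "s > 0" for s using that unfolding q_def by simp
  have xC: "x s \<in> C" for s using x unfolding QVI_solutions_def by blast
  define T where "T = tangent_cone C x0"
  \<comment> \<open>\<open>M\<close> bounds the difference quotients \<open>q s\<close>, and
    \<open>R\<close> bounds the functionals \<open>A (q s) - k\<close>, uniformly in
    \<open>s > 0\<close>.\<close>
  define M where "M = norm k / ca"
  define R where "R = cb * M + norm k"
  have M0: "M \<ge> 0" and R0: "R \<ge> 0" unfolding M_def R_def using ca_pos cb_pos by auto
  have qM: "norm (q s) \<le> M" if s: "s > 0" for s
  proof -
    have "norm (x s - x0) \<le> norm (s *\<^sub>R k) / ca" using VI_lipschitz[OF x x0, of s] by simp
    thus ?thesis using s ca_pos unfolding q_def M_def norm_inverse_scaleR[OF s]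
      by (simp add: field_simps)
  qed
  have qT: "q s \<in> T" if s: "s > 0" for s
    using radial_coneI[OF C(2) x0C s] xq[OF s] xC[of s] closure_subset
    unfolding T_def tangent_cone_def by (metis subsetD)
  have \<mu>q: "blinfun_apply \<mu> (q s) \<le> 0" if s: "s > 0" for s
  proof -
    have "blinfun_apply (A x0 - g0) (x0 - x s) \<le> 0" using x0 xC unfolding QVI_solutions_def by blast
    hence "blinfun_apply \<mu> (x s - x0) \<le> 0" unfolding \<mu>_def by (simp add: blinfun.bilinear_simps)
    thus ?thesis using s unfolding q_def by (simp add: blinfun.scaleR_right mult_nonneg_nonpos)
  qed
  have test: "blinfun_apply (A (q s) - k) (q s - d) \<le> blinfun_apply \<mu> (q s) / s"
    if s: "s > 0" and d: "x0 + s *\<^sub>R d \<in> C" "d \<in> annihilator \<mu>" for s d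
  proof -
    have "blinfun_apply (A (x s) - (g0 + s *\<^sub>R k)) (x s - (x0 + s *\<^sub>R d)) \<le> 0"
      using x d(1) unfolding QVI_solutions_def by blast
    also have "blinfun_apply (A (x s) - (g0 + s *\<^sub>R k)) (x s - (x0 + s *\<^sub>R d))
        = s * (s * blinfun_apply (A (q s) - k) (q s - d) - blinfun_apply \<mu> (q s - d))"
      unfolding xq[OF s] \<mu>_def by (simp add: A_simps blinfun.bilinear_simps algebra_simps)
    also have "blinfun_apply \<mu> (q s - d) = blinfun_apply \<mu> (q s)"
      using d(2) by (simp add: annihilator_def blinfun.diff_right)
    finally have "s * blinfun_apply (A (q s) - k) (q s - d) \<le> blinfun_apply \<mu> (q s)"
      using s by (simp add: mult_le_0_iff)
    thus ?thesis using s by (simp add: field_simps)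
  qed
  have AR: "\<bar>blinfun_apply (A (q s) - k) v\<bar> \<le> R * norm v" if s: "s > 0" for s v
  proof -
    have "norm (A (q s) - k) \<le> cb * norm (q s) + norm k"
      using norm_triangle_ineq4[of "A (q s)" k] norm_A_le[of "q s"] by linarith
    also have "\<dots> \<le> R" unfolding R_def using qM[OF s] cb_pos by simp
    finally have "norm (A (q s) - k) * norm v \<le> R * norm v" by (rule mult_right_mono) simp
    thus ?thesis using norm_blinfun[of "A (q s) - k" v] by simp
  qed
  \<comment> \<open>Testing with \<open>d = 0\<close> bounds \<open>\<mu> (q s)\<close> below by a
    multiple of \<open>s\<close>; with \<open>\<mu>q\<close> this drives the quotients towards the
    annihilator of \<open>\<mu>\<close>.\<close>
  have \<mu>q_lower: "- (s * (R * M)) \<le> blinfun_apply \<mu> (q s)" if s: "s > 0" for s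
  proof -
    have "blinfun_apply (A (q s) - k) (q s) \<le> blinfun_apply \<mu> (q s) / s"
      using test[OF s, of 0] x0C by (simp add: annihilator_def)
    moreover have "- (R * M) \<le> blinfun_apply (A (q s) - k) (q s)"
      using AR[OF s, of "q s"] mult_left_mono[OF qM[OF s] R0] by linarith
    ultimately have "- (R * M) \<le> blinfun_apply \<mu> (q s) / s" by linarith
    thus ?thesis using s by (simp add: field_simps)
  qed
  define f where "f = A \<delta> - k"
  have \<delta>_mem: "\<delta> \<in> T \<inter> annihilator \<mu>" using \<delta> unfolding QVI_solutions_def T_def by blast
  have VI\<delta>: "blinfun_apply f (\<delta> - v) \<le> 0" if "v \<in> T \<inter> annihilator \<mu>" for v
    using \<delta> that unfolding QVI_solutions_def T_def f_def by blast
  have zero: "0 \<in> T \<inter> annihilator \<mu>" using critical_cone(3)[OF C(2) x0C] unfolding T_def .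
  have f\<delta>: "blinfun_apply f \<delta> \<le> 0" using VI\<delta>[OF zero] by simp
  \<comment> \<open>The critical cone is closed under doubling, so testing with 0 and with
    \<open>2 *\<^sub>R \<delta>\<close> forces \<open>f \<delta> = 0\<close>; hence \<open>f\<close>
    is nonnegative on the cone.\<close>
  have cone: "2 *\<^sub>R \<delta> \<in> T \<inter> annihilator \<mu>"
  proof -
    have "2 *\<^sub>R h \<in> radial_cone C x0" if h: "h \<in> radial_cone C x0" for h
    proof -
      obtain t where "t > 0" "x0 + t *\<^sub>R h \<in> C" using h unfolding radial_cone_def by force
      thus ?thesis using radial_coneI[OF C(2) x0C, of "t / 2" "2 *\<^sub>R h"] by simp
    qed
    hence "(*\<^sub>R) 2 ` radial_cone C x0 \<subseteq> radial_cone C x0" by blast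
    hence "closure ((*\<^sub>R) 2 ` radial_cone C x0) \<subseteq> T"
      unfolding T_def tangent_cone_def by (rule closure_mono)
    hence "(*\<^sub>R) 2 ` T \<subseteq> T"
      unfolding closure_scaleR[symmetric] T_def tangent_cone_def .
    thus ?thesis using \<delta>_mem by (auto simp: annihilator_def blinfun.scaleR_right)
  qed
  have "blinfun_apply f (\<delta> - 2 *\<^sub>R \<delta>) \<le> 0" by (rule VI\<delta>[OF cone])
  hence f\<delta>0: "blinfun_apply f \<delta> = 0" using f\<delta> by (simp add: blinfun.bilinear_simps)
  have f_nonneg: "0 \<le> blinfun_apply f v" if "v \<in> T \<inter> annihilator \<mu>" for v
    using VI\<delta>[OF that] f\<delta>0 by (simp add: blinfun.diff_right)
  have T: "closed T" "convex T"
    unfolding T_def tangent_cone_def by (auto intro: convex_closure convex_radial_cone[OF C(2) x0C])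
  have "(q \<longlongrightarrow> \<delta>) (at_right 0)"
    unfolding tendsto_iff
  proof (intro allI impI)
    fix \<eta> :: real assume \<eta>: "\<eta> > 0"
    \<comment> \<open>Two errors of size \<open>e\<close> will occur: replacing
      \<open>\<delta>\<close> by the radial direction \<open>d\<close>, and the negative part of
      \<open>f (q s)\<close>. Their sum \<open>2 * e\<close> stays below
      \<open>ca * \<eta>\<^sup>2\<close>.\<close>
    define e where "e = ca * \<eta>\<^sup>2 / 4"
    have e: "e > 0" unfolding e_def using \<eta> ca_pos by simp
    have "e / (R + 1) > 0" using e R0 by simp
    then obtain d where d: "d \<in> radial_cone C x0 \<inter> annihilator \<mu>" "dist d \<delta> < e / (R + 1)"
      using poly \<delta>_mem closure_approachable unfolding T_def by (metis subsetD)
    obtain s0 where s0: "s0 > 0" "\<And>s. s \<in> {0..s0} \<Longrightarrow> x0 + s *\<^sub>R d \<in> C"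
      using d(1) unfolding radial_cone_def by blast
    obtain r where r: "r > 0" "\<And>v. v \<in> T \<Longrightarrow> norm v \<le> M \<Longrightarrow> \<bar>blinfun_apply \<mu> v\<bar> \<le> r
        \<Longrightarrow> - e < blinfun_apply f v"
      using almost_nonneg_near_annihilator[OF T f_nonneg e] by blast
    have RM: "R * M + 1 > 0" using R0 M0 by (simp add: add_nonneg_pos)
    have "min s0 (r / (R * M + 1)) > 0" using s0(1) r(1) RM by simp
    from at_right_0_eventually_le[OF this] show "\<forall>\<^sub>F s in at_right 0. dist (q s) \<delta> < \<eta>"
    proof eventually_elim
      case (elim s)
      hence s: "s > 0" "s \<le> s0" "s * (R * M + 1) \<le> r" using RM by (auto simp: field_simps)
      have "s * (R * M) \<le> r" using s by (simp add: algebra_simps)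
      hence "- e < blinfun_apply f (q s)"
        using \<mu>q[OF s(1)] \<mu>q_lower[OF s(1)] by (intro r(2) qT qM s) auto
      moreover have "blinfun_apply (A (q s) - k) (q s - d) \<le> 0"
      proof -
        have "blinfun_apply (A (q s) - k) (q s - d) \<le> blinfun_apply \<mu> (q s) / s"
          using s s0(2) d(1) by (intro test) auto
        also have "\<dots> \<le> 0" using \<mu>q[OF s(1)] s(1) by (simp add: divide_nonpos_pos)
        finally show ?thesis .
      qed
      moreover have "blinfun_apply (A (q s) - k) (d - \<delta>) \<le> e"
      proof -
        have "blinfun_apply (A (q s) - k) (d - \<delta>) \<le> R * norm (d - \<delta>)"
          using AR[OF s(1), of "d - \<delta>"] by simp
        also have "\<dots> \<le> (R + 1) * (e / (R + 1))"
          using d(2) R0 e by (intro mult_mono) (auto simp: dist_norm)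
        finally show ?thesis using R0 by simp
      qed
      \<comment> \<open>Inserting \<open>d\<close> splits the energy of the error into the
        quantities just estimated.\<close>
      moreover have "blinfun_apply (A (q s - \<delta>)) (q s - \<delta>)
          = blinfun_apply (A (q s) - k) (q s - d) + blinfun_apply (A (q s) - k) (d - \<delta>)
            - blinfun_apply f (q s) + blinfun_apply f \<delta>"
        unfolding f_def by (simp add: A_simps blinfun.bilinear_simps)
      ultimately have "blinfun_apply (A (q s - \<delta>)) (q s - \<delta>) < 2 * e" using f\<delta> by linarith
      also have "2 * e < ca * \<eta>\<^sup>2" using e unfolding e_def by simp
      finally have "ca * (norm (q s - \<delta>))\<^sup>2 < ca * \<eta>\<^sup>2" using coercive[of "q s - \<delta>"] by linarith
      hence "(norm (q s - \<delta>))\<^sup>2 < \<eta>\<^sup>2" using ca_pos by simp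
      thus ?case using \<eta> by (simp add: dist_norm power2_less_imp_less)
    qed
  qed
  thus ?thesis unfolding q_def x_def .
qed

text \<open>The auxiliary points \<open>z s\<close> solve the problem with the shift frozen at the
  predictor \<open>y0 + s *\<^sub>R \<alpha>\<close>. The derivative of the variational inequality
  shows that they follow the predictor up to o(s), and the contraction carries this over to the QVI
  solutions \<open>Y s\<close>.\<close>

lemma QVI_directional_derivative:
  assumes C: "closed C" "convex C" and K: "\<And>w. K w = (\<lambda>z. \<phi> w + z) ` C"
    and \<phi>0: "\<phi> y0 = 0" and y0: "y0 \<in> QVI_solutions A K g0"
    and \<epsilon>: "\<epsilon> > 0" and L: "L-lipschitz_on (cball y0 \<epsilon>) \<phi>" and small: "(1 + cb / ca) * L < 1"
  defines "\<mu> \<equiv> g0 - A y0"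
  assumes poly: "tangent_cone C y0 \<inter> annihilator \<mu> \<subseteq> closure (radial_cone C y0 \<inter> annihilator \<mu>)"
    and K': "\<And>w. K' w = (\<lambda>z. \<phi>' w + z) ` (tangent_cone C y0 \<inter> annihilator \<mu>)"
    and \<alpha>: "\<alpha> \<in> QVI_solutions A K' h"
    and \<phi>': "((\<lambda>s. inverse s *\<^sub>R \<phi> (y0 + s *\<^sub>R \<alpha>)) \<longlongrightarrow> \<phi>' \<alpha>) (at_right 0)"
  shows "\<exists>Y. (\<forall>\<^sub>F s in at_right 0. Y s \<in> QVI_solutions A K (g0 + s *\<^sub>R h))
    \<and> ((\<lambda>s. inverse s *\<^sub>R (Y s - y0)) \<longlongrightarrow> \<alpha>) (at_right 0)"
proof -
  define \<kappa> where "\<kappa> = (1 + cb / ca) * L"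
  have \<kappa>: "\<kappa> < 1" "0 \<le> \<kappa>"
    using small lipschitz_on_nonneg[OF L] ca_pos cb_pos unfolding \<kappa>_def by auto
  have y0_VI: "y0 \<in> VI C g0"
    using y0 unfolding QVI_translate_iff[OF K] by (simp add: \<phi>0 A_simps)
  hence ne: "C \<noteq> {}" unfolding QVI_solutions_def by blast
  define \<beta> where "\<beta> = \<phi>' \<alpha>"
  define k where "k = h - A \<beta>"
  have \<delta>: "\<alpha> - \<beta> \<in> VI (tangent_cone C y0 \<inter> annihilator \<mu>) k"
    using \<alpha> unfolding QVI_translate_iff[OF K'] \<beta>_def k_def .
  define p where "p s = \<phi> (y0 + s *\<^sub>R \<alpha>)" for s
  define x where "x s = VI_sol C (g0 + s *\<^sub>R k)" for s
  define z where "z s = p s + VI_sol C (g0 + s *\<^sub>R h - A (p s))" for s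
  have z_VI: "z s - p s \<in> VI C (g0 + s *\<^sub>R h - A (p s))" for s
    unfolding z_def using VI_sol_mem[OF C ne] by simp
  \<comment> \<open>Solvability in the ball is shown only for small \<open>s > 0\<close>; for other
    \<open>s\<close> the value is arbitrary.\<close>
  define Y where "Y s = (SOME y. y \<in> cball y0 \<epsilon> \<and> y \<in> QVI_solutions A K (g0 + s *\<^sub>R h))" for s
  have "1 - \<kappa> > 0" using \<kappa> by simp
  hence "ca * (1 - \<kappa>) * \<epsilon> / (norm h + 1) > 0" using \<epsilon> ca_pos by (simp add: add_nonneg_pos)
  from at_right_0_eventually_le[OF this]
  have Y: "\<forall>\<^sub>F s in at_right 0. Y s \<in> cball y0 \<epsilon> \<and> Y s \<in> QVI_solutions A K (g0 + s *\<^sub>R h)"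
  proof eventually_elim
    case (elim s)
    have "s * norm h \<le> s * (norm h + 1)" using elim by simp
    also have "\<dots> \<le> ca * (1 - \<kappa>) * \<epsilon>"
      using elim by (simp add: pos_le_divide_eq add_nonneg_pos)
    finally have "norm (g0 + s *\<^sub>R h - g0) / ca \<le> (1 - \<kappa>) * \<epsilon>"
      using elim ca_pos by (simp add: field_simps)
    hence "\<exists>y. y \<in> cball y0 \<epsilon> \<and> y \<in> QVI_solutions A K (g0 + s *\<^sub>R h)"
      using QVI_exists_near[OF C ne K L small \<epsilon> y0] unfolding \<kappa>_def by blast
    thus ?case unfolding Y_def by (rule someI_ex)
  qed
  define \<rho> where "\<rho> s = norm (inverse s *\<^sub>R (z s - y0) - \<alpha>)" for s
  have "((\<lambda>s. inverse s *\<^sub>R (z s - y0)) \<longlongrightarrow> \<alpha>) (at_right 0)"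
  proof -
    have p_lim: "((\<lambda>s. inverse s *\<^sub>R p s) \<longlongrightarrow> \<beta>) (at_right 0)" using \<phi>' unfolding p_def \<beta>_def .
    have x_lim: "((\<lambda>s. inverse s *\<^sub>R (x s - y0)) \<longlongrightarrow> \<alpha> - \<beta>) (at_right 0)"
      unfolding x_def using VI_directional_derivative[OF C y0_VI poly[unfolded \<mu>_def]] \<delta>
      unfolding \<mu>_def by blast
    \<comment> \<open>Replacing \<open>A (p s)\<close> by its first-order term
      \<open>s *\<^sub>R A \<beta>\<close> changes the solution only by o(s), because
      \<open>p s / s\<close> tends to \<open>\<beta>\<close>.\<close>
    have "((\<lambda>s. inverse s *\<^sub>R (z s - p s - x s)) \<longlongrightarrow> 0) (at_right 0)"
    proof (rule Lim_null_comparison)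
      show "\<forall>\<^sub>F s in at_right 0. norm (inverse s *\<^sub>R (z s - p s - x s))
          \<le> norm (A (\<beta> - inverse s *\<^sub>R p s)) / ca"
        using eventually_at_right_less
      proof eventually_elim
        case (elim s)
        have "norm (z s - p s - x s) \<le> norm (g0 + s *\<^sub>R h - A (p s) - (g0 + s *\<^sub>R k)) / ca"
          unfolding x_def by (rule VI_lipschitz[OF z_VI VI_sol_mem[OF C ne]])
        also have "g0 + s *\<^sub>R h - A (p s) - (g0 + s *\<^sub>R k) = s *\<^sub>R A (\<beta> - inverse s *\<^sub>R p s)"
          unfolding k_def using elim by (simp add: A_simps algebra_simps)
        finally show ?case unfolding norm_inverse_scaleR[OF elim] using elim by (simp add: field_simps)
      qed
      have "((\<lambda>s. norm (A (\<beta> - inverse s *\<^sub>R p s)) / ca) \<longlongrightarrow> norm (A (\<beta> - \<beta>)) / ca) (at_right 0)"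
        using ca_pos
        by (intro tendsto_intros bounded_linear.tendsto[OF bounded_linear_A] p_lim) auto
      thus "((\<lambda>s. norm (A (\<beta> - inverse s *\<^sub>R p s)) / ca) \<longlongrightarrow> 0) (at_right 0)"
        by (simp add: A_simps)
    qed
    from tendsto_add[OF tendsto_add[OF this x_lim] p_lim]
    show ?thesis by (simp add: algebra_simps)
  qed
  hence \<rho>: "(\<rho> \<longlongrightarrow> 0) (at_right 0)" unfolding \<rho>_def using LIM_zero tendsto_norm_zero by blast
  have ball: "\<forall>\<^sub>F s in at_right 0. y0 + s *\<^sub>R \<alpha> \<in> cball y0 \<epsilon>"
    by (rule eventually_line_in_cball[OF \<epsilon>])
  have "((\<lambda>s. inverse s *\<^sub>R (Y s - y0) - \<alpha>) \<longlongrightarrow> 0) (at_right 0)"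
  proof (rule Lim_null_comparison)
    show "\<forall>\<^sub>F s in at_right 0. norm (inverse s *\<^sub>R (Y s - y0) - \<alpha>) \<le> \<rho> s / (1 - \<kappa>)"
      using Y ball eventually_at_right_less
    proof eventually_elim
      case (elim s)
      \<comment> \<open>\<open>E\<close> is the distance to the predictor. The contraction gives
        \<open>E (Y s) \<le> \<kappa> * E (Y s) + E (z s)\<close>, and the first term is
        absorbed.\<close>
      define E where "E y = norm (y - (y0 + s *\<^sub>R \<alpha>))" for y
      have E: "norm (inverse s *\<^sub>R (y - y0) - \<alpha>) = E y / s" for y
      proof -
        have "inverse s *\<^sub>R (y - y0) - \<alpha> = inverse s *\<^sub>R (y - (y0 + s *\<^sub>R \<alpha>))"
          using elim by (simp add: algebra_simps)
        thus ?thesis using norm_inverse_scaleR elim unfolding E_def by metis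
      qed
      have "norm (Y s - z s) \<le> (1 + cb / ca) * norm (\<phi> (Y s) - p s)"
        using VI_translate_lipschitz[OF _ z_VI, of "Y s" "\<phi> (Y s)" "g0 + s *\<^sub>R h" s] elim
        unfolding QVI_translate_iff[OF K] by simp
      also have "\<dots> \<le> (1 + cb / ca) * (L * E (Y s))"
        using lipschitz_onD[OF L, of "Y s" "y0 + s *\<^sub>R \<alpha>"] elim ca_pos cb_pos
        unfolding E_def p_def by (intro mult_left_mono) (simp_all only: dist_norm, auto)
      finally have "norm (Y s - z s) \<le> \<kappa> * E (Y s)" unfolding \<kappa>_def by (simp add: mult.assoc)
      moreover have "E (Y s) \<le> norm (Y s - z s) + E (z s)"
        unfolding E_def using norm_triangle_ineq[of "Y s - z s" "z s - (y0 + s *\<^sub>R \<alpha>)"]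
        by (simp only: add_diff_eq diff_add_cancel)
      ultimately have "(1 - \<kappa>) * E (Y s) \<le> E (z s)" by (simp add: algebra_simps)
      hence "E (Y s) \<le> E (z s) / (1 - \<kappa>)"
        using \<kappa> by (simp add: pos_le_divide_eq mult.commute)
      hence "E (Y s) / s \<le> E (z s) / (1 - \<kappa>) / s" using elim by (intro divide_right_mono) auto
      hence "E (Y s) / s \<le> E (z s) / s / (1 - \<kappa>)" by (simp only: divide_divide_eq_left mult.commute)
      thus ?case unfolding \<rho>_def E .
    qed
    show "((\<lambda>s. \<rho> s / (1 - \<kappa>)) \<longlongrightarrow> 0) (at_right 0)"
      using tendsto_divide_zero[OF \<rho>] .
  qed
  hence "((\<lambda>s. inverse s *\<^sub>R (Y s - y0)) \<longlongrightarrow> \<alpha>) (at_right 0)" by (rule LIM_zero_cancel)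
  moreover have "\<forall>\<^sub>F s in at_right 0. Y s \<in> QVI_solutions A K (g0 + s *\<^sub>R h)"
    using Y by eventually_elim blast
  ultimately show ?thesis by blast
qed

end

section \<open>Polyhedricity of obstacle constraints\<close>

lemma is_cone_sup_unique:
  assumes "P \<inter> uminus ` P = {0}" and v: "is_cone_sup P a b v" and w: "is_cone_sup P a b w"
  shows "v = w"
proof -
  have "w - v \<in> P" "v - w \<in> P" using v w unfolding is_cone_sup_def cone_le_def by blast+
  moreover have "w - v = - (v - w)" by simp
  ultimately have "w - v \<in> P \<inter> uminus ` P" by (metis IntI imageI)
  thus ?thesis unfolding assms(1) by simp
qed

lemma is_cone_sup_cone_sup:
  assumes "vector_lattice_cone P" shows "is_cone_sup P a b (cone_sup P a b)"
proof -
  have P: "P \<inter> uminus ` P = {0}" using assms unfolding vector_lattice_cone_def by blast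
  obtain w where w: "is_cone_sup P a b w" using assms unfolding vector_lattice_cone_def by blast
  have "cone_sup P a b = w"
    unfolding cone_sup_def using w is_cone_sup_unique[OF P _ w] by (rule the_equality)
  thus ?thesis using w by simp
qed

text \<open>If \<open>v n \<rightarrow> v\<close> are radial, then \<open>v n\<^sup>+ - v\<^sup>-\<close> are radial, annihilated by \<open>\<mu>\<close>, and converge
  weakly to \<open>v\<close>; by convexity, \<open>v\<close> lies in the strong closure.\<close>

lemma (in coercive_operator) lattice_polyhedric:
  fixes P :: "'v set" and \<psi> :: 'v
  assumes P: "vector_lattice_cone P"
    and sup_cont: "\<And>vn v. vn \<longlonglongrightarrow> v \<Longrightarrow> weakly_converges (\<lambda>n. cone_sup P 0 (vn n)) (cone_sup P 0 v)"
  defines "C \<equiv> {v. cone_le P v \<psi>}"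
  assumes y: "y \<in> C" and \<mu>: "\<And>v. v \<in> C \<Longrightarrow> blinfun_apply \<mu> (v - y) \<le> 0"
  shows "tangent_cone C y \<inter> annihilator \<mu> \<subseteq> closure (radial_cone C y \<inter> annihilator \<mu>)"
proof
  have cone: "convex P" "0 \<in> P" "\<And>a p. a \<ge> 0 \<Longrightarrow> p \<in> P \<Longrightarrow> a *\<^sub>R p \<in> P"
    "\<And>p q. p \<in> P \<Longrightarrow> q \<in> P \<Longrightarrow> p + q \<in> P"
  proof -
    have "convex_cone P" using P unfolding vector_lattice_cone_def by blast
    thus "convex P" "a \<ge> 0 \<Longrightarrow> p \<in> P \<Longrightarrow> a *\<^sub>R p \<in> P" "p \<in> P \<Longrightarrow> q \<in> P \<Longrightarrow> p + q \<in> P" for a p q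
      using convex_cone_iff[of P] unfolding convex_cone_def by blast+
    show "0 \<in> P" using P unfolding vector_lattice_cone_def by blast
  qed
  define c where "c = \<psi> - y"
  have c: "c \<in> P" using y unfolding c_def C_def cone_le_def by simp
  have C_iff: "y + h \<in> C \<longleftrightarrow> c - h \<in> P" for h
    unfolding c_def C_def cone_le_def by (simp add: diff_diff_eq)
  have convC: "convex C"
    unfolding convex_alt
  proof (intro ballI allI impI)
    fix a b and u :: real assume "a \<in> C" "b \<in> C" "0 \<le> u \<and> u \<le> 1"
    hence "(1 - u) *\<^sub>R (\<psi> - a) + u *\<^sub>R (\<psi> - b) \<in> P"
      using cone(1) unfolding C_def cone_le_def convex_alt by simp
    thus "(1 - u) *\<^sub>R a + u *\<^sub>R b \<in> C" unfolding C_def cone_le_def by (simp add: algebra_simps)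
  qed
  \<comment> \<open>Lowering \<open>y\<close> by an element of the cone keeps it feasible. In
    \<open>\<mu>c\<close> the feasible point is the obstacle \<open>\<psi> = y + c\<close> itself:
    complementarity.\<close>
  have \<mu>P: "0 \<le> blinfun_apply \<mu> p" if "p \<in> P" for p
    using \<mu>[of "y + - p"] C_iff[of "- p"] cone(4)[OF c that] by (simp add: blinfun.minus_right)
  have \<mu>c: "blinfun_apply \<mu> c = 0"
    using \<mu>[of "y + c"] C_iff[of c] cone(2) \<mu>P[OF c] by simp
  define pos where "pos = cone_sup P 0"
  have pos: "pos v \<in> P" "pos v - v \<in> P" "\<And>z. z \<in> P \<Longrightarrow> z - v \<in> P \<Longrightarrow> z - pos v \<in> P" for v
    using is_cone_sup_cone_sup[OF P, of 0 v] unfolding pos_def is_cone_sup_def cone_le_def by auto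
  fix v assume v: "v \<in> tangent_cone C y \<inter> annihilator \<mu>"
  hence "v \<in> closure (radial_cone C y)" unfolding tangent_cone_def by blast
  then obtain vn where vn: "\<And>n. vn n \<in> radial_cone C y" "vn \<longlonglongrightarrow> v"
    unfolding closure_sequential by blast
  \<comment> \<open>The element \<open>inverse t *\<^sub>R c\<close> dominates both 0 and
    \<open>vn n\<close>, hence also their supremum.\<close>
  have below: "\<exists>t>0. inverse t *\<^sub>R c - pos (vn n) \<in> P" for n
  proof -
    obtain t where t: "t > 0" "y + t *\<^sub>R vn n \<in> C" using vn(1)[of n] unfolding radial_cone_def by force
    hence "inverse t *\<^sub>R (c - t *\<^sub>R vn n) \<in> P" unfolding C_iff by (intro cone(3)) auto
    hence "inverse t *\<^sub>R c - vn n \<in> P" using t(1) by (simp add: algebra_simps)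
    moreover have "inverse t *\<^sub>R c \<in> P" using t(1) c by (intro cone(3)) auto
    ultimately show ?thesis using pos(3) t(1) by blast
  qed
  \<comment> \<open>\<open>\<mu>\<close> is monotone and vanishes at both ends of the order interval
    from 0 to \<open>inverse t *\<^sub>R c\<close>, which contains the positive part.\<close>
  have \<mu>pos: "blinfun_apply \<mu> (pos (vn n)) = 0" for n
  proof -
    obtain t where "inverse t *\<^sub>R c - pos (vn n) \<in> P" using below by blast
    from \<mu>P[OF this] \<mu>P[OF pos(1)[of "vn n"]] show ?thesis by (simp add: blinfun.bilinear_simps \<mu>c)
  qed
  have weak: "weakly_converges (\<lambda>n. pos (vn n)) (pos v)"
    unfolding pos_def by (rule sup_cont[OF vn(2)])
  hence "(\<lambda>n. blinfun_apply \<mu> (pos (vn n))) \<longlonglongrightarrow> blinfun_apply \<mu> (pos v)"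
    unfolding weakly_converges_def by blast
  hence \<mu>posv: "blinfun_apply \<mu> (pos v) = 0" by (simp add: \<mu>pos LIMSEQ_const_iff)
  define w where "w n = pos (vn n) - (pos v - v)" for n
  have "w n \<in> annihilator \<mu>" for n
    using v unfolding w_def annihilator_def by (simp add: blinfun.bilinear_simps \<mu>pos \<mu>posv)
  moreover have "w n \<in> radial_cone C y" for n
  proof -
    obtain t where t: "t > 0" "inverse t *\<^sub>R c - pos (vn n) \<in> P" using below by blast
    \<comment> \<open>Subtracting the negative part of \<open>v\<close> only moves further below the
      obstacle, so the step length \<open>t\<close> remains admissible.\<close>
    have "t *\<^sub>R (inverse t *\<^sub>R c - pos (vn n)) + t *\<^sub>R (pos v - v) \<in> P"
      using t by (intro cone(4) cone(3) pos(2)) auto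
    also have "t *\<^sub>R (inverse t *\<^sub>R c - pos (vn n)) + t *\<^sub>R (pos v - v) = c - t *\<^sub>R w n"
      using t(1) unfolding w_def by (simp add: algebra_simps)
    finally show ?thesis unfolding C_iff[symmetric] using radial_coneI[OF convC y t(1)] by blast
  qed
  moreover have "weakly_converges w v"
    unfolding weakly_converges_def
  proof
    fix f :: "'v \<Rightarrow>\<^sub>L real"
    have "(\<lambda>n. blinfun_apply f (pos (vn n))) \<longlonglongrightarrow> blinfun_apply f (pos v)"
      using weak unfolding weakly_converges_def by blast
    from tendsto_diff[OF this tendsto_const[of "blinfun_apply f (pos v - v)"]]
    show "(\<lambda>n. blinfun_apply f (w n)) \<longlonglongrightarrow> blinfun_apply f v"
      unfolding w_def by (simp add: blinfun.diff_right)
  qed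
  ultimately have w: "\<And>n. w n \<in> closure (radial_cone C y \<inter> annihilator \<mu>)"
    and "weakly_converges w v"
    using closure_subset by blast+
  moreover have "convex (closure (radial_cone C y \<inter> annihilator \<mu>))"
    by (intro convex_closure convex_Int convex_radial_cone[OF convC y] convex_annihilator)
  ultimately show "v \<in> closure (radial_cone C y \<inter> annihilator \<mu>)"
    using weak_limit_in_closed_convex[OF closed_closure] by blast
qed

section \<open>The optimality condition\<close>

lemma has_hadamard_derivative_directional:
  assumes "has_hadamard_derivative \<Phi> \<Phi>' y"
  shows "((\<lambda>s. inverse s *\<^sub>R (\<Phi> (y + s *\<^sub>R h) - \<Phi> y)) \<longlongrightarrow> \<Phi>' h) (at_right 0)"
  by (rule assms[unfolded has_hadamard_derivative_def, rule_format, OF tendsto_const])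

text \<open>For small \<open>s\<close> the difference quotients are \<open>L\<close>-Lipschitz in
  the direction, and the limit inherits the constant. So the linearised QVI is a contraction on the
  whole space.\<close>

lemma lipschitz_on_hadamard_derivative:
  fixes y :: "'v::real_normed_vector"
  assumes d: "has_hadamard_derivative \<Phi> \<Phi>' y" and \<epsilon>: "\<epsilon> > 0" and L: "L-lipschitz_on (cball y \<epsilon>) \<Phi>"
  shows "L-lipschitz_on UNIV \<Phi>'"
proof (rule lipschitz_onI)
  show "0 \<le> L" using L by (rule lipschitz_on_nonneg)
  fix a b :: 'v
  note ball = eventually_line_in_cball[OF \<epsilon>, of y]
  have "\<forall>\<^sub>F s in at_right 0. dist (inverse s *\<^sub>R (\<Phi> (y + s *\<^sub>R a) - \<Phi> y))
      (inverse s *\<^sub>R (\<Phi> (y + s *\<^sub>R b) - \<Phi> y)) \<le> L * dist a b"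
    using ball[of a] ball[of b] eventually_at_right_less
  proof eventually_elim
    case (elim s)
    have "dist (\<Phi> (y + s *\<^sub>R a)) (\<Phi> (y + s *\<^sub>R b)) \<le> L * dist (y + s *\<^sub>R a) (y + s *\<^sub>R b)"
      using elim by (intro lipschitz_onD[OF L])
    also have "dist (y + s *\<^sub>R a) (y + s *\<^sub>R b) = s * dist a b"
      using elim by (simp add: dist_norm scaleR_diff_right[symmetric])
    finally have le: "norm (\<Phi> (y + s *\<^sub>R a) - \<Phi> (y + s *\<^sub>R b)) \<le> L * (s * dist a b)"
      by (simp add: dist_norm)
    have "inverse s *\<^sub>R (\<Phi> (y + s *\<^sub>R a) - \<Phi> y) - inverse s *\<^sub>R (\<Phi> (y + s *\<^sub>R b) - \<Phi> y)
        = inverse s *\<^sub>R (\<Phi> (y + s *\<^sub>R a) - \<Phi> (y + s *\<^sub>R b))" by (simp add: algebra_simps)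
    thus ?case
      using le elim(3) by (simp only: dist_norm norm_inverse_scaleR) (simp add: pos_divide_le_eq mult_ac)
  qed
  thus "dist (\<Phi>' a) (\<Phi>' b) \<le> L * dist a b"
    by (rule tendsto_upperbound[OF tendsto_dist[OF has_hadamard_derivative_directional[OF d]
          has_hadamard_derivative_directional[OF d]]]) simp
qed

theorem proposition5p2:
  fixes \<iota> :: "'v::banach \<Rightarrow>\<^sub>L 'h::{real_inner, complete_space}"
    and P :: "'v set"
    and A :: "'v \<Rightarrow> ('v \<Rightarrow>\<^sub>L real)"
    and \<Phi> \<Phi>' :: "'v \<Rightarrow> 'v"
    and U_ad :: "'h set"
    and C_a C_b C_\<Phi> \<epsilon> \<nu> :: real
    and y_d u_opt :: 'h
    and y_opt :: 'v
  assumes "reflexive_space TYPE('v)"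
    and "inj (blinfun_apply \<iota>)"
    and "vector_lattice_cone P"
    and "\<And>vn v. vn \<longlonglongrightarrow> v \<Longrightarrow> weakly_converges (\<lambda>n. cone_sup P 0 (vn n)) (cone_sup P 0 v)"
    and "linear A"
    and "C_a > 0" and "C_b > 0"
    and "\<And>u v. blinfun_apply (A u) v \<le> C_b * norm u * norm v"
    and "\<And>u. blinfun_apply (A u) u \<ge> C_a * (norm u)\<^sup>2"
    and "\<And>u. blinfun_apply (A (pos_part P u)) (neg_part P u) \<le> 0"
    and "U_ad \<noteq> {}" and "weakly_seq_closed U_ad"
    and "\<nu> > 0"
    and "local_minimiser (objective \<iota> y_d \<nu>) U_ad
           (\<lambda>u. QVI_solutions A (constraint_set P \<Phi>) (dual_of \<iota> u)) y_opt u_opt"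
    and "\<epsilon> > 0" and "C_\<Phi>-lipschitz_on (cball y_opt \<epsilon>) \<Phi>" and "C_\<Phi> < C_a / (C_a + C_b)"
    and "has_hadamard_derivative \<Phi> \<Phi>' y_opt"
  defines "\<K> \<equiv> linearised_constraint_set \<Phi>' (constraint_set P \<Phi> y_opt) y_opt
                   (dual_of \<iota> u_opt - A y_opt)"
  shows "\<forall>h\<in>tangent_cone U_ad u_opt.
           (\<exists>!\<alpha>. \<alpha> \<in> QVI_solutions A \<K> (dual_of \<iota> h)) \<and>
           (\<forall>\<alpha>\<in>QVI_solutions A \<K> (dual_of \<iota> h).
              inner (blinfun_apply \<iota> \<alpha>) (blinfun_apply \<iota> y_opt - y_d) + \<nu> * inner u_opt h \<ge> 0)"
proof -
  note P = assms(3) and sup_cont = assms(4) and min = assms(14) and \<epsilon> = assms(15) and L = assms(16)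
    and deriv = assms(18)
  interpret coercive_operator A C_a C_b
    by (rule coercive_operator.intro[OF assms(5-9)])
  \<comment> \<open>The smallness hypothesis on \<open>C_\<Phi>\<close>, rewritten as a contraction
    condition.\<close>
  have small: "(1 + C_b / C_a) * C_\<Phi> < 1"
    using assms(6,7,17) by (simp add: field_simps)
  define g0 where "g0 = dual_of \<iota> u_opt"
  define K where "K = constraint_set P \<Phi>"
  define C where "C = {v. cone_le P v (\<Phi> y_opt)}"
  define \<mu> where "\<mu> = g0 - A y_opt"
  define Crit where "Crit = tangent_cone C y_opt \<inter> annihilator \<mu>"
  \<comment> \<open>Normalising the obstacle map to vanish at \<open>y_opt\<close> presents every
    \<open>K w\<close> as a translate of the fixed set \<open>C = K y_opt\<close>.\<close>
  define \<phi> where "\<phi> w = \<Phi> w - \<Phi> y_opt" for w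
  have K: "K w = (\<lambda>z. \<phi> w + z) ` C" for w
  proof -
    have "v \<in> (\<lambda>z. \<phi> w + z) ` C" if "\<Phi> w - v \<in> P" for v
      using that unfolding \<phi>_def C_def cone_le_def
      by (intro image_eqI[of _ _ "v - (\<Phi> w - \<Phi> y_opt)"]) auto
    thus ?thesis unfolding K_def constraint_set_def \<phi>_def C_def cone_le_def by (auto simp: algebra_simps)
  qed
  have K': "\<K> w = (\<lambda>z. \<Phi>' w + z) ` Crit" for w
    unfolding \<K>_def linearised_constraint_set_def Crit_def \<mu>_def g0_def C_def constraint_set_def ..
  have y0: "y_opt \<in> QVI_solutions A K g0"
    using min unfolding local_minimiser_def K_def g0_def by blast
  have \<phi>0: "\<phi> y_opt = 0" unfolding \<phi>_def by simp
  have L\<phi>: "C_\<Phi>-lipschitz_on (cball y_opt \<epsilon>) \<phi>"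
    using L unfolding lipschitz_on_def \<phi>_def by (simp add: dist_norm)
  have y0_VI: "y_opt \<in> VI C g0"
    using y0 unfolding QVI_translate_iff[OF K] by (simp add: \<phi>0 A_simps)
  hence y0C: "y_opt \<in> C" unfolding QVI_solutions_def by blast
  have convC: "convex C" and closedC: "closed C"
  proof -
    have "C = (\<lambda>p. \<Phi> y_opt - p) ` P" unfolding C_def cone_le_def
      by (auto intro: image_eqI[of _ _ "\<Phi> y_opt - _"])
    hence "C = (+) (\<Phi> y_opt) ` uminus ` P" by (simp add: image_image)
    thus "convex C" "closed C" using P
      unfolding vector_lattice_cone_def convex_cone_def
      by (auto intro: convex_translation convex_negations closed_translation closed_negations)
  qed
  have "blinfun_apply \<mu> (v - y_opt) \<le> 0" if "v \<in> C" for v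
  proof -
    have "blinfun_apply (A y_opt - g0) (y_opt - v) \<le> 0"
      using y0_VI that unfolding QVI_solutions_def by blast
    thus ?thesis unfolding \<mu>_def by (simp add: blinfun.bilinear_simps)
  qed
  hence poly: "tangent_cone C y_opt \<inter> annihilator \<mu> \<subseteq> closure (radial_cone C y_opt \<inter> annihilator \<mu>)"
    using lattice_polyhedric[OF P sup_cont] y0C unfolding C_def by blast
  have Crit: "closed Crit" "convex Crit" "Crit \<noteq> {}"
    using critical_cone[OF convC y0C, of \<mu>] unfolding Crit_def by blast+
  have L': "C_\<Phi>-lipschitz_on UNIV \<Phi>'" by (rule lipschitz_on_hadamard_derivative[OF deriv \<epsilon> L])
  have ex: "\<exists>\<alpha>. \<alpha> \<in> QVI_solutions A \<K> g" for g
    using QVI_exists[OF Crit K' L' complete_UNIV UNIV_not_empty small] by blast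
  have lip: "(1 - (1 + C_b / C_a) * C_\<Phi>) * norm (\<alpha> - \<beta>) \<le> norm (f - g) / C_a"
    if "\<alpha> \<in> QVI_solutions A \<K> f" "\<beta> \<in> QVI_solutions A \<K> g" for \<alpha> \<beta> f g
    using QVI_lipschitz[OF K' L'] that by blast
  have unique: "\<alpha> = \<beta>" if "\<alpha> \<in> QVI_solutions A \<K> g" "\<beta> \<in> QVI_solutions A \<K> g" for \<alpha> \<beta> g
    using lip[OF that] small by (simp add: mult_le_0_iff)
  \<comment> \<open>The derivative of the objective at \<open>(y_opt, u_opt)\<close> in the
    direction \<open>(\<alpha>, h)\<close>.\<close>
  define W where "W h \<alpha> = inner (blinfun_apply \<iota> \<alpha>) (blinfun_apply \<iota> y_opt - y_d) + \<nu> * inner u_opt h"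
    for h \<alpha>
  have dual_add: "dual_of \<iota> (u + s *\<^sub>R h) = dual_of \<iota> u + s *\<^sub>R dual_of \<iota> h" for u h s
    unfolding dual_of_def by (rule blinfun_eqI) (simp add: blinfun.bilinear_simps inner_simps)
  have radial: "0 \<le> W h \<alpha>"
    if h: "h \<in> radial_cone U_ad u_opt" and \<alpha>: "\<alpha> \<in> QVI_solutions A \<K> (dual_of \<iota> h)" for h \<alpha>
  proof -
    have "((\<lambda>s. inverse s *\<^sub>R \<phi> (y_opt + s *\<^sub>R \<alpha>)) \<longlongrightarrow> \<Phi>' \<alpha>) (at_right 0)"
      unfolding \<phi>_def by (rule has_hadamard_derivative_directional[OF deriv])
    then obtain Y where Y: "\<forall>\<^sub>F s in at_right 0. Y s \<in> QVI_solutions A K (g0 + s *\<^sub>R dual_of \<iota> h)"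
        and lim: "((\<lambda>s. inverse s *\<^sub>R (Y s - y_opt)) \<longlongrightarrow> \<alpha>) (at_right 0)"
      using QVI_directional_derivative[OF closedC convC K \<phi>0 y0 \<epsilon> L\<phi> small
          poly[unfolded \<mu>_def] K'[unfolded Crit_def \<mu>_def] \<alpha>] by blast
    define q where "q s = inverse s *\<^sub>R (Y s - y_opt)" for s
    have q: "(q \<longlongrightarrow> \<alpha>) (at_right 0)" using lim unfolding q_def .
    have id0: "((\<lambda>s::real. s) \<longlongrightarrow> 0) (at_right 0)" by (rule tendsto_ident_at)
    obtain r where r: "r > 0" "\<And>u y. u \<in> U_ad \<Longrightarrow> y \<in> QVI_solutions A K (dual_of \<iota> u) \<Longrightarrow>
        dist (y, u) (y_opt, u_opt) < r \<Longrightarrow> objective \<iota> y_d \<nu> y_opt u_opt \<le> objective \<iota> y_d \<nu> y u"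
      using min unfolding local_minimiser_def K_def by blast
    obtain s0 where s0: "s0 > 0" "\<And>s. s \<in> {0..s0} \<Longrightarrow> u_opt + s *\<^sub>R h \<in> U_ad"
      using h unfolding radial_cone_def by blast
    have "((\<lambda>s. dist (y_opt + s *\<^sub>R q s, u_opt + s *\<^sub>R h) (y_opt, u_opt)) \<longlongrightarrow>
        dist (y_opt + 0 *\<^sub>R \<alpha>, u_opt + 0 *\<^sub>R h) (y_opt, u_opt)) (at_right 0)"
      by (intro tendsto_intros q id0)
    hence "\<forall>\<^sub>F s in at_right 0. dist (y_opt + s *\<^sub>R q s, u_opt + s *\<^sub>R h) (y_opt, u_opt) < r"
      using r(1) by (intro order_tendstoD(2)) auto
    with Y at_right_0_eventually_le[OF s0(1)]
    have "\<forall>\<^sub>F s in at_right 0. 0 \<le> W h (q s)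
        + s * (1/2 * (norm (blinfun_apply \<iota> (q s)))\<^sup>2 + \<nu> / 2 * (norm h)\<^sup>2)"
    proof eventually_elim
      case (elim s)
      have s: "s > 0" and Ys: "Y s = y_opt + s *\<^sub>R q s" using elim unfolding q_def by auto
      have "objective \<iota> y_d \<nu> y_opt u_opt \<le> objective \<iota> y_d \<nu> (Y s) (u_opt + s *\<^sub>R h)"
        using elim s0(2) by (intro r(2)) (auto simp: dual_add g0_def Ys[symmetric])
      \<comment> \<open>The objective is quadratic, so this expansion is exact; dividing by
        \<open>s\<close> leaves \<open>W\<close> plus a remainder that vanishes with
        \<open>s\<close>.\<close>
      also have "\<dots> = objective \<iota> y_d \<nu> y_opt u_opt + s * (W h (q s)
          + s * (1/2 * (norm (blinfun_apply \<iota> (q s)))\<^sup>2 + \<nu> / 2 * (norm h)\<^sup>2))"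
        unfolding objective_def W_def Ys power2_norm_eq_inner
        by (simp add: blinfun.bilinear_simps inner_simps inner_commute field_simps power2_eq_square)
      finally show ?case using s by (simp add: zero_le_mult_iff)
    qed
    moreover have "((\<lambda>s. W h (q s) + s * (1/2 * (norm (blinfun_apply \<iota> (q s)))\<^sup>2 + \<nu> / 2 * (norm h)\<^sup>2))
        \<longlongrightarrow> W h \<alpha> + 0 * (1/2 * (norm (blinfun_apply \<iota> \<alpha>))\<^sup>2 + \<nu> / 2 * (norm h)\<^sup>2)) (at_right 0)"
      unfolding W_def by (intro tendsto_intros q id0)
    ultimately have "0 \<le> W h \<alpha> + 0 * (1/2 * (norm (blinfun_apply \<iota> \<alpha>))\<^sup>2 + \<nu> / 2 * (norm h)\<^sup>2)"
      by (intro tendsto_lowerbound) auto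
    thus ?thesis by simp
  qed
  \<comment> \<open>Tangent directions are limits of radial ones; the stability bound
    \<open>lip\<close> makes the linearised solutions converge along the sequence, and
    \<open>W\<close> is continuous.\<close>
  have "0 \<le> W h \<alpha>"
    if h: "h \<in> tangent_cone U_ad u_opt" and \<alpha>: "\<alpha> \<in> QVI_solutions A \<K> (dual_of \<iota> h)" for h \<alpha>
  proof -
    obtain hn where hn: "\<And>n. hn n \<in> radial_cone U_ad u_opt" "hn \<longlonglongrightarrow> h"
      using h unfolding tangent_cone_def closure_sequential by blast
    define \<alpha>n where "\<alpha>n n = (SOME \<alpha>. \<alpha> \<in> QVI_solutions A \<K> (dual_of \<iota> (hn n)))" for n
    have \<alpha>n: "\<alpha>n n \<in> QVI_solutions A \<K> (dual_of \<iota> (hn n))" for n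
      unfolding \<alpha>n_def using ex by (rule someI_ex)
    have pos: "1 - (1 + C_b / C_a) * C_\<Phi> > 0" using small by simp
    have "(\<lambda>n. \<alpha>n n - \<alpha>) \<longlonglongrightarrow> 0"
    proof (rule Lim_null_comparison)
      show "\<forall>\<^sub>F n in sequentially. norm (\<alpha>n n - \<alpha>)
          \<le> norm (dual_of \<iota> (hn n) - dual_of \<iota> h) / C_a / (1 - (1 + C_b / C_a) * C_\<Phi>)"
        using lip[OF \<alpha>n \<alpha>] pos
        by (intro always_eventually allI) (simp only: pos_le_divide_eq mult.commute)
      have "(\<lambda>n. norm (dual_of \<iota> (hn n) - dual_of \<iota> h) / C_a / (1 - (1 + C_b / C_a) * C_\<Phi>))
          \<longlonglongrightarrow> norm (dual_of \<iota> h - dual_of \<iota> h) / C_a / (1 - (1 + C_b / C_a) * C_\<Phi>)"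
        unfolding dual_of_def using hn(2) pos assms(6)
        by (intro tendsto_intros bounded_linear.tendsto[OF bounded_linear_blinfun_inner_right]
            bounded_bilinear.tendsto[OF bounded_bilinear_blinfun_compose]) auto
      thus "(\<lambda>n. norm (dual_of \<iota> (hn n) - dual_of \<iota> h) / C_a / (1 - (1 + C_b / C_a) * C_\<Phi>))
          \<longlonglongrightarrow> 0" by simp
    qed
    hence "\<alpha>n \<longlonglongrightarrow> \<alpha>" by (rule LIM_zero_cancel)
    hence "(\<lambda>n. W (hn n) (\<alpha>n n)) \<longlonglongrightarrow> W h \<alpha>"
      unfolding W_def by (intro tendsto_intros hn(2))
    thus ?thesis using radial[OF hn(1) \<alpha>n] by (intro LIMSEQ_le_const) auto
  qed
  thus ?thesis using ex unique unfolding W_def by blast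
qed

end
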